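(* Let $n\ge1$ and $k\ge0$. For $A\in\{1,\dots,n\}^k$ and $B\subset\{1,\dots,n\}$ with $|B|=k+1$, let $\tilde A=c^{1-\rho(A,B)}A$, $\tilde B=c^{1-\rho(A,B)}B$, let $I=(i_1\le\dots\le i_k)$ be the non-decreasing rearrangement of $\tilde A$, let $(j_1,\dots,j_k)=\Pi(I,\tilde B)$, and let $\sigma\in\mathfrak S_k$ be any permutation with $\sigma\cdot\tilde A=I$. Then $i_l<j_l$ for all $l$, $((i_1\,j_1),\dots,(i_k\,j_k))\in\Sigma_n(k)$, and $\Gamma_{n,k}(A,B)=\sigma^{-1}\cdot((i_1\,j_1),\dots,(i_k\,j_k))\in\Sigma_n(k)$ does not depend on the choice of $\sigma$. The resulting map $\Gamma_{n,k}:\{1,\dots,n\}^k\times\binom{\{1,\dots,n\}}{k+1}\to\Sigma_n(k)$ is surjective, and its fibres are exactly the orbits of the shift action of $\mathbb Z/n\mathbb Z$ (generated by $(A,B)\mapsto(cA,cB)$), each of which has exactly $n$ elements. Consequently $|\Sigma_n(k)|=n^{k-1}\binom{n}{k+1}$.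
   Context: $\mathfrak S_n$ is the symmetric group on $\{1,\dots,n\}$; products are composed right to left. $\mathsf T_n$ is the set of transpositions, always written $(i\,j)$ with $i<j$. For $\sigma\in\mathfrak S_n$, $|\sigma|=n-(\text{number of cycles of }\sigma\text{, fixed points counted})$; $\sigma_1\preccurlyeq\sigma_2$ iff $|\sigma_2|=|\sigma_1|+|\sigma_1^{-1}\sigma_2|$. $\Sigma_n(k)=\{(\tau_1,\dots,\tau_k)\in(\mathsf T_n)^k : |\tau_1\cdots\tau_k|=k,\ \tau_1\cdots\tau_k\preccurlyeq(1\,2\,\dots\,n)\}$ (the $k$-prefixes of minimal factorisations of the $n$-cycle). $\binom{\{1,\dots,n\}}{k+1}$ is the set of $(k+1)$-element subsets. Let $c=(1\,2\,\dots\,n)$ be the cyclic shift $x\mapsto x+1$ for $x<n$, $n\mapsto1$, acting componentwise on sequences and elementwise on sets; powers are taken modulo $n$. Parking process: given $E=(e_1,\dots,e_k)\in\{1,\dots,n\}^k$ and $O\subset\{1,\dots,n\}$ with $|O|=k+1$, define $p_k=c^{r}(e_k)$ where $r=\min\{s\in\{1,\dots,n\}: c^s(e_k)\in O\}$ and, backwards, $p_l=c^{r}(e_l)$ where $r=\min\{s\in\{1,\dots,n\}: c^s(e_l)\in O\setminus\{p_{l+1},\dots,p_k\}\}$; $\Pi(E,O)=(p_1,\dots,p_k)$ and the residue $\rho(E,O)$ is the unique element of $O\setminus\{p_1,\dots,p_k\}$. $\mathfrak S_k$ acts on sequences by $\pi\cdot(x_1,\dots,x_k)=(x_{\pi^{-1}(1)},\dots,x_{\pi^{-1}(k)})$,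 and on $\Sigma_n(k)$ as follows: for the generator $\sigma_l=(l\;l+1)$ and $\gamma=((i_1\,j_1),\dots,(i_k\,j_k))=(g_1,\dots,g_k)$, $\sigma_l\cdot\gamma=\gamma$ if $i_l=i_{l+1}$; $\sigma_l\cdot\gamma=(g_1,\dots,g_{l-1},g_{l+1},g_{l+1}^{-1}g_lg_{l+1},g_{l+2},\dots,g_k)$ if $i_l<i_{l+1}$; and $\sigma_l\cdot\gamma=(g_1,\dots,g_{l-1},g_lg_{l+1}g_l^{-1},g_l,g_{l+2},\dots,g_k)$ if $i_l>i_{l+1}$; these generator actions extend to an action of $\mathfrak S_k$ on $\Sigma_n(k)$. *)

theory Defs
  imports Complex_Main "HOL-Combinatorics.Combinatorics"
begin

(* Permutations of {1..n} are functions nat => nat permuting {1..n}. *)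

definition cyc :: "nat \<Rightarrow> nat \<Rightarrow> nat" where
  "cyc n x = (if 1 \<le> x \<and> x < n then x + 1 else if x = n then 1 else x)"

definition cpow :: "nat \<Rightarrow> int \<Rightarrow> nat \<Rightarrow> nat" where
  "cpow n z = cyc n ^^ nat (z mod int n)"

definition ncycles :: "nat \<Rightarrow> (nat \<Rightarrow> nat) \<Rightarrow> nat" where
  "ncycles n s = card ((\<lambda>x. {(s ^^ m) x | m. True}) ` {1..n})"

definition plen :: "nat \<Rightarrow> (nat \<Rightarrow> nat) \<Rightarrow> nat" where
  "plen n s = n - ncycles n s"

definition prec :: "nat \<Rightarrow> (nat \<Rightarrow> nat) \<Rightarrow> (nat \<Rightarrow> nat) \<Rightarrow> bool" where
  "prec n s1 s2 \<longleftrightarrow> plen n s2 = plen n s1 + plen n (inv s1 \<circ> s2)"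

(* a transposition (i j), i<j, of T_n is represented by the pair (i,j) *)
definition is_transp :: "nat \<Rightarrow> nat \<times> nat \<Rightarrow> bool" where
  "is_transp n t \<longleftrightarrow> 1 \<le> fst t \<and> fst t < snd t \<and> snd t \<le> n"

definition tr :: "nat \<times> nat \<Rightarrow> nat \<Rightarrow> nat" where
  "tr t = Transposition.transpose (fst t) (snd t)"

definition prodT :: "(nat \<times> nat) list \<Rightarrow> nat \<Rightarrow> nat" where
  "prodT ts = foldr (\<lambda>t f. tr t \<circ> f) ts id"

definition Sigma :: "nat \<Rightarrow> nat \<Rightarrow> (nat \<times> nat) list set" where
  "Sigma n k = {ts. length ts = k \<and> (\<forall>t\<in>set ts. is_transp n t)
      \<and> plen n (prodT ts) = k \<and> prec n (prodT ts) (cyc n)}"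

(* g h g^{-1} for transpositions g, h, written again as a pair (i,j), i<j *)
definition conjT :: "nat \<times> nat \<Rightarrow> nat \<times> nat \<Rightarrow> nat \<times> nat" where
  "conjT g h = (let x = tr g (fst h); y = tr g (snd h) in (min x y, max x y))"

(* action of the generator sigma_l = (l l+1), 1 <= l <= k-1, on a k-tuple of transpositions
   (lists are 0-indexed: g_l = ts ! (l-1)) *)
definition hgen :: "nat \<Rightarrow> (nat \<times> nat) list \<Rightarrow> (nat \<times> nat) list" where
  "hgen l ts = (let g1 = ts ! (l - 1); g2 = ts ! l in
     if fst g1 = fst g2 then ts
     else if fst g1 < fst g2 then ts[l - 1 := g2, l := conjT g2 g1]
     else ts[l - 1 := conjT g1 g2, l := g1])"

definition perm_of_word :: "nat list \<Rightarrow> nat \<Rightarrow> nat" where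
  "perm_of_word ws = foldr (\<lambda>l f. Transposition.transpose l (l + 1) \<circ> f) ws id"

definition apply_word :: "nat list \<Rightarrow> (nat \<times> nat) list \<Rightarrow> (nat \<times> nat) list" where
  "apply_word ws ts = foldr hgen ws ts"

(* action of pi in S_k (k = length ts) on Sigma_n(k): apply any word in the generators
   representing pi (the context asserts the generator actions extend to an action) *)
definition act :: "(nat \<Rightarrow> nat) \<Rightarrow> (nat \<times> nat) list \<Rightarrow> (nat \<times> nat) list" where
  "act p ts = apply_word
     (SOME ws. set ws \<subseteq> {1..<length ts} \<and> perm_of_word ws = p) ts"

definition seq_act :: "(nat \<Rightarrow> nat) \<Rightarrow> 'a list \<Rightarrow> 'a list" where
  "seq_act p xs = map (\<lambda>i. xs ! (inv p (i + 1) - 1)) [0..<length xs]"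

fun parking :: "nat \<Rightarrow> nat set \<Rightarrow> nat list \<Rightarrow> nat list" where
  "parking n Os [] = []"
| "parking n Os (e # es) = (let ps = parking n Os es in
     (cyc n ^^ (LEAST s. 1 \<le> s \<and> s \<le> n \<and> (cyc n ^^ s) e \<in> Os - set ps)) e # ps)"

definition residue :: "nat \<Rightarrow> nat list \<Rightarrow> nat set \<Rightarrow> nat" where
  "residue n E Os = (THE x. x \<in> Os - set (parking n Os E))"

definition shiftA :: "nat \<Rightarrow> nat list \<Rightarrow> nat set \<Rightarrow> nat list" where
  "shiftA n A B = map (cpow n (1 - int (residue n A B))) A"

definition shiftB :: "nat \<Rightarrow> nat list \<Rightarrow> nat set \<Rightarrow> nat set" where
  "shiftB n A B = cpow n (1 - int (residue n A B)) ` B"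

definition Iseq :: "nat \<Rightarrow> nat list \<Rightarrow> nat set \<Rightarrow> nat list" where
  "Iseq n A B = sort (shiftA n A B)"

definition Jseq :: "nat \<Rightarrow> nat list \<Rightarrow> nat set \<Rightarrow> nat list" where
  "Jseq n A B = parking n (shiftB n A B) (Iseq n A B)"

definition gamma0 :: "nat \<Rightarrow> nat list \<Rightarrow> nat set \<Rightarrow> (nat \<times> nat) list" where
  "gamma0 n A B = zip (Iseq n A B) (Jseq n A B)"

definition Gamma :: "nat \<Rightarrow> nat list \<Rightarrow> nat set \<Rightarrow> (nat \<times> nat) list" where
  "Gamma n A B = act (inv (SOME s. s permutes {1..length A} \<and> seq_act s (shiftA n A B) = Iseq n A B))
                     (gamma0 n A B)"

definition Dom :: "nat \<Rightarrow> nat \<Rightarrow> (nat list \<times> nat set) set" where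
  "Dom n k = {A. length A = k \<and> set A \<subseteq> {1..n}} \<times> {B. B \<subseteq> {1..n} \<and> card B = k + 1}"

definition shift_orbit :: "nat \<Rightarrow> nat list \<times> nat set \<Rightarrow> (nat list \<times> nat set) set" where
  "shift_orbit n p = {(map (cyc n ^^ m) (fst p), (cyc n ^^ m) ` snd p) | m. True}"

end

theory Submission
  imports Defs
begin

text \<open>Two invariants drive the proof: a minimal prefix is determined by the sequence of its left
  endpoints together with its product. The generators permute the left endpoints and preserve the
  product, so it suffices to treat prefixes with non-decreasing left endpoints. For those,
  minimality means that the half-open intervals \<open>[i, j)\<close> form a laminar family of a prescribed
  shape: each of them is stable under \<open>\<tau>\<^sub>k \<cdots> \<tau>\<^sub>1 c\<close>, whose cycles they separate. The same shape
  says that \<open>j\<^sub>l\<close> is the first free spot after \<open>i\<^sub>l\<close>, i.e. that the right endpoints are produced by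
  the parking process on \<open>{1} \<union> {j\<^sub>1, \<dots>, j\<^sub>k}\<close> with residue 1. The set of occupied spots does not
  depend on the order of the cars and the process commutes with the cyclic shift, so every shift
  orbit is free and contains exactly one pair with residue 1.\<close>

section \<open>Cycles and multiplication by a transposition\<close>

text \<open>The length conditions are read as extremal cycle counts. The long cycle has one cycle
  and a transposition adds at most one, so \<open>prodT (rev ts) \<circ> cyc n\<close> has at most
  \<open>k + 1\<close> cycles; the prefix relation says that this bound is attained, and estimates
  on cycle counts then do most of the work. The intervals are half-open because the long cycle moves
  \<open>x\<close> to \<open>x + 1\<close>: it carries \<open>[i, j)\<close> onto
  \<open>(i, j]\<close>, and the transposition of \<open>i\<close> and \<open>j\<close> brings
  \<open>j\<close> back to \<open>i\<close>. Parking follows the same convention, since a car starts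
  its search one step beyond its preference. Among equal preferences the last car parks first and
  hence nearest, so later intervals with the same left end are shorter. The generators conjugate, so
  right endpoints change under the action. The occupied spots can therefore be read off a prefix
  only after it has been sorted.\<close>

definition orb :: "('a \<Rightarrow> 'a) \<Rightarrow> 'a \<Rightarrow> 'a set" where
  "orb f x = {(f ^^ m) x | m. True}"

lemma ncycles_orb: "ncycles n f = card (orb f ` {1..n})"
  by (simp add: ncycles_def orb_def)

lemma orb_self: "x \<in> orb f x"
  unfolding orb_def by (auto intro: exI[of _ 0])

lemma orb_step: "f x \<in> orb f x"
  unfolding orb_def by (auto intro!: exI[of _ "Suc 0"])

text \<open>An orbit collects forward iterates only, so symmetry needs finite order: if
  \<open>f ^^ N = id\<close>, then \<open>N * m - m\<close> further steps lead from
  \<open>(f ^^ m) x\<close> back to \<open>x\<close>.\<close>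

lemma orb_eqI:
  assumes "f permutes S" "finite S" "y \<in> orb f x"
  shows "orb f y = orb f x"
proof -
  have "permutation f" using assms(1,2) permutation_permutes by blast
  then obtain N where N: "f ^^ N = id" "N > 0"
    using permutation_is_nilpotent by blast
  obtain m where m: "y = (f ^^ m) x" using assms(3) by (auto simp: orb_def)
  have idN: "(f ^^ (N * j)) z = z" for j z
    by (induction j) (simp_all add: funpow_add N)
  have "(f ^^ (N * m - m)) y = (f ^^ (N * m)) x"
    unfolding m using N(2) by (simp flip: funpow_add comp_apply[of "f ^^ _" "f ^^ _"])
  then have x: "x = (f ^^ (N * m - m)) y" by (simp add: idN)
  have "(f ^^ i) y = (f ^^ (i + m)) x" "(f ^^ i) x = (f ^^ (i + (N * m - m))) y" for i
    using m x by (simp_all add: funpow_add)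
  then show ?thesis unfolding orb_def by blast
qed

lemma orb_subset:
  assumes "\<And>y. y \<in> T \<Longrightarrow> f y \<in> T" "x \<in> T"
  shows "orb f x \<subseteq> T"
proof -
  have "(f ^^ m) x \<in> T" for m by (induction m) (auto simp: assms)
  then show ?thesis by (auto simp: orb_def)
qed

text \<open>Orbits of \<open>g\<close> that avoid \<open>a\<close> and \<open>b\<close> are orbits
  of \<open>f\<close>, so passing from \<open>f\<close> to \<open>g\<close> only replaces the orbits
  of these two points. The cardinality of a pair, 1 or 2, covers splitting and merging at once, and
  the additive form keeps truncated subtraction away.\<close>

lemma ncycles_transpose_comp:
  assumes f: "f permutes {1..n}" and a: "a \<in> {1..n}" and b: "b \<in> {1..n}"
  defines "g \<equiv> Transposition.transpose a b \<circ> f"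
  shows "ncycles n g + card {orb f a, orb f b} \<le> ncycles n f + card {orb g a, orb g b}"
proof -
  have g: "g permutes {1..n}"
    unfolding g_def using f a b by (intro permutes_compose permutes_swap_id) auto
  have sub: "orb g ` {1..n} \<subseteq> (orb f ` {1..n} - {orb f a, orb f b}) \<union> {orb g a, orb g b}"
  proof (rule image_subsetI)
    fix x assume x: "x \<in> {1..n}"
    show "orb g x \<in> (orb f ` {1..n} - {orb f a, orb f b}) \<union> {orb g a, orb g b}"
    proof (cases "a \<in> orb g x \<or> b \<in> orb g x")
      case True
      then show ?thesis using orb_eqI[OF g] by fastforce
    next
      case False
      have "(g ^^ m) x = (f ^^ m) x" for m
      proof (induction m)
        case (Suc m)
        have step: "(g ^^ Suc m) x = Transposition.transpose a b ((f ^^ Suc m) x)"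
          using Suc by (metis g_def comp_apply funpow.simps(2))
        have "(g ^^ Suc m) x \<noteq> a" "(g ^^ Suc m) x \<noteq> b"
          using False unfolding orb_def by blast+
        then show ?case unfolding step by (auto simp: Transposition.transpose_def split: if_splits)
      qed simp
      then have "orb g x = orb f x" by (simp add: orb_def)
      moreover have "orb f x \<noteq> orb f a" "orb f x \<noteq> orb f b"
        using False orb_self[of a f] orb_self[of b f] calculation by metis+
      ultimately show ?thesis using x by blast
    qed
  qed
  have "ncycles n g \<le> card ((orb f ` {1..n} - {orb f a, orb f b}) \<union> {orb g a, orb g b})"
    unfolding ncycles_orb by (rule card_mono[OF _ sub]) simp
  also have "\<dots> \<le> card (orb f ` {1..n} - {orb f a, orb f b}) + card {orb g a, orb g b}"
    by (rule card_Un_le)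
  also have "card (orb f ` {1..n} - {orb f a, orb f b}) = ncycles n f - card {orb f a, orb f b}"
    unfolding ncycles_orb by (rule card_Diff_subset) (use a b in auto)
  finally have "ncycles n g \<le> ncycles n f - card {orb f a, orb f b} + card {orb g a, orb g b}" .
  moreover have "card {orb f a, orb f b} \<le> ncycles n f"
    unfolding ncycles_orb by (rule card_mono) (use a b in auto)
  ultimately show ?thesis by linarith
qed

lemma card_pair_bounds: "1 \<le> card {u, v}" "card {u, v} \<le> 2" "u \<noteq> v \<Longrightarrow> card {u, v} = 2"
  by (auto simp: card_insert_if)

lemma ncycles_transpose_comp_le:
  assumes "f permutes {1..n}" "a \<in> {1..n}" "b \<in> {1..n}"
  shows "ncycles n (Transposition.transpose a b \<circ> f) \<le> ncycles n f + 1"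
  using ncycles_transpose_comp[OF assms]
    card_pair_bounds(1)[of "orb f a" "orb f b"]
    card_pair_bounds(2)[of "orb (Transposition.transpose a b \<circ> f) a" "orb (Transposition.transpose a b \<circ> f) b"]
  by linarith

lemma ncycles_le_transpose_comp:
  assumes "f permutes {1..n}" "a \<in> {1..n}" "b \<in> {1..n}"
  shows "ncycles n f \<le> ncycles n (Transposition.transpose a b \<circ> f) + 1"
proof -
  have "Transposition.transpose a b \<circ> (Transposition.transpose a b \<circ> f) = f"
    by (simp add: fun_eq_iff)
  moreover have "Transposition.transpose a b \<circ> f permutes {1..n}"
    using assms by (intro permutes_compose permutes_swap_id) auto
  ultimately show ?thesis using ncycles_transpose_comp_le[OF _ assms(2,3)] by metis
qed

text \<open>Used contrapositively: if the number of cycles grows, then \<open>a\<close> and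
  \<open>b\<close> lay in a common cycle. For that purpose it suffices that two orbits are replaced
  by at most two.\<close>

lemma ncycles_transpose_comp_merge:
  assumes "f permutes {1..n}" "a \<in> {1..n}" "b \<in> {1..n}" "orb f a \<noteq> orb f b"
  shows "ncycles n (Transposition.transpose a b \<circ> f) \<le> ncycles n f"
  using ncycles_transpose_comp[OF assms(1-3)] card_pair_bounds(3)[OF assms(4)]
    card_pair_bounds(2)[of "orb (Transposition.transpose a b \<circ> f) a" "orb (Transposition.transpose a b \<circ> f) b"]
  by linarith

text \<open>As \<open>f b = b\<close>, right multiplication by the transposition of \<open>a\<close>
  and \<open>b\<close> is left multiplication by that of \<open>f a\<close> and \<open>b\<close>.
  The singleton cycle of \<open>b\<close> is thereby inserted into the cycle of \<open>f a\<close>,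
  which costs exactly one cycle.\<close>

lemma ncycles_comp_transpose_fixpoint:
  assumes f: "f permutes {1..n}" and a: "a \<in> {1..n}" and b: "b \<in> {1..n}" and "f b = b" "a \<noteq> b"
  shows "ncycles n (f \<circ> Transposition.transpose a b) + 1 = ncycles n f"
proof -
  have fa: "f a \<in> {1..n}" using f a permutes_in_image by fastforce
  have inj: "inj f" using f by (rule permutes_inj)
  define g where "g = Transposition.transpose (f a) b \<circ> f"
  have g_eq: "f \<circ> Transposition.transpose a b = g"
    proof
    fix x
    show "(f \<circ> Transposition.transpose a b) x = g x"
    proof (cases "x = a \<or> x = b")
      case False
      then have "f x \<noteq> f a" "f x \<noteq> b" using inj \<open>f b = b\<close> by (metis injD)+
      then show ?thesis using False by (simp add: g_def)
    qed (use \<open>f b = b\<close> in \<open>auto simp: g_def\<close>)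
  qed
  have g: "g permutes {1..n}"
    unfolding g_def using f fa b by (intro permutes_compose permutes_swap_id) auto
  have "orb f b \<subseteq> {b}" by (rule orb_subset) (use \<open>f b = b\<close> in auto)
  moreover have "f a \<noteq> b" using \<open>f b = b\<close> \<open>a \<noteq> b\<close> inj by (metis injD)
  ultimately have "orb f (f a) \<noteq> orb f b" using orb_self[of "f a" f] by auto
  then have "card {orb f (f a), orb f b} = 2" by (rule card_pair_bounds(3))
  moreover have "f a \<in> orb g b" using orb_step[of g b] \<open>f b = b\<close> by (simp add: g_def)
  then have "orb g (f a) = orb g b" using orb_eqI[OF g] by blast
  ultimately have "ncycles n g + 1 \<le> ncycles n f"
    using ncycles_transpose_comp[OF f fa b] by (simp add: g_def)
  moreover have "ncycles n f \<le> ncycles n g + 1"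
    unfolding g_def by (rule ncycles_le_transpose_comp[OF f fa b])
  ultimately show ?thesis using g_eq by simp
qed

lemma ncycles_id: "ncycles n id = n"
proof -
  have "orb id x = {x}" for x :: nat
    using orb_subset[of "{x}" id x] orb_self[of x id] by auto
  then have "orb id ` {1..n} = (\<lambda>x. {x}) ` {1..n}" by simp
  then show ?thesis unfolding ncycles_orb by (simp add: card_image)
qed

lemma ncycles_le: "ncycles n f \<le> n"
  unfolding ncycles_orb using card_image_le[of "{1..n}" "orb f"] by simp

section \<open>Powers of the long cycle\<close>

lemma cyc_mod: "x \<in> {1..n} \<Longrightarrow> cyc n x = x mod n + 1"
  by (cases "x = n") (auto simp: cyc_def)

lemma cyc_in: "x \<in> {1..n} \<Longrightarrow> cyc n x \<in> {1..n}"
  by (auto simp: cyc_def)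

lemma cyc_pow_in: "x \<in> {1..n} \<Longrightarrow> (cyc n ^^ s) x \<in> {1..n}"
  by (induction s) (use cyc_in in auto)

lemma cyc_pow: "y < n \<Longrightarrow> (cyc n ^^ s) (Suc y) = Suc ((y + s) mod n)"
proof (induction s)
  case (Suc s)
  have "Suc ((y + s) mod n) \<in> {1..n}" using Suc.prems by (auto simp: Suc_le_eq)
  from cyc_mod[OF this] show ?case using Suc by (simp add: mod_simps)
qed simp

lemma cyc_fix: "x \<notin> {1..n} \<Longrightarrow> n \<ge> 1 \<Longrightarrow> cyc n x = x"
  by (auto simp: cyc_def)

lemma cyc_pow_outside: "x \<notin> {1..n} \<Longrightarrow> n \<ge> 1 \<Longrightarrow> (cyc n ^^ s) x = x"
  by (induction s) (auto simp: cyc_fix)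

lemma cyc_pow_n: "n \<ge> 1 \<Longrightarrow> cyc n ^^ n = id"
proof
  fix x assume "n \<ge> 1"
  then show "(cyc n ^^ n) x = id x"
  proof (cases "x \<in> {1..n}")
    case True
    then obtain y where "x = Suc y" "y < n" by (cases x) auto
    then show ?thesis by (simp add: cyc_pow)
  qed (simp add: cyc_pow_outside)
qed

lemma cyc_pow_mod: "n \<ge> 1 \<Longrightarrow> cyc n ^^ (m mod n) = cyc n ^^ m"
  by (rule ext, rule funpow_mod_eq) (simp add: cyc_pow_n)

text \<open>The powers of the long cycle act freely, so one point determines the exponent modulo
  \<open>n\<close>. Both the uniqueness of the normalising shift and the size of the shift orbits
  rest on this.\<close>

lemma cyc_pow_eqD:
  assumes "x \<in> {1..n}" "(cyc n ^^ s) x = (cyc n ^^ t) x"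
  shows "s mod n = t mod n"
proof -
  obtain y where y: "x = Suc y" "y < n" using assms(1) by (cases x) auto
  have "(y + s) mod n = (y + t) mod n" using assms(2) y by (simp add: cyc_pow)
  then show ?thesis by (simp add: nat_mod_eq_iff)
qed

lemma cyc_pow_unique:
  assumes "n \<ge> 1" "x \<in> {1..n}" "(cyc n ^^ s) x = (cyc n ^^ t) x"
  shows "cyc n ^^ s = cyc n ^^ t"
  using cyc_pow_eqD[OF assms(2,3)] cyc_pow_mod[OF assms(1)] by metis

lemma bij_cyc_pow: "n \<ge> 1 \<Longrightarrow> bij (cyc n ^^ s)"
proof -
  assume n: "n \<ge> 1"
  have "cyc n \<circ> (cyc n ^^ (n - 1)) = id" "(cyc n ^^ (n - 1)) \<circ> cyc n = id"
    using cyc_pow_n[OF n] n by (simp_all flip: funpow.simps(2) funpow_Suc_right)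
  then have "bij (cyc n)" using o_bij by blast
  then show ?thesis by (rule bij_fn)
qed

lemma cyc_permutes: "n \<ge> 1 \<Longrightarrow> cyc n permutes {1..n}"
  using bij_cyc_pow[of n 1] cyc_fix by (auto simp: permutes_def bij_iff)

lemma cyc_pow_image:
  assumes "n \<ge> 1" shows "(cyc n ^^ s) ` {1..n} = {1..n}"
proof (rule endo_inj_surj)
  show "inj_on (cyc n ^^ s) {1..n}"
    using bij_cyc_pow[OF assms] by (auto simp: bij_def intro: inj_on_subset)
qed (use cyc_pow_in in auto)

text \<open>The exponent ranges over \<open>1..n\<close> and not \<open>0..n-1\<close>, as in the
  parking rule: a car gets back to its own preference only after a full turn.\<close>

lemma cyc_pow_reach:
  assumes "n \<ge> 1" "x \<in> {1..n}" "y \<in> {1..n}"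
  obtains s where "1 \<le> s" "s \<le> n" "(cyc n ^^ s) x = y"
proof -
  obtain u v where uv: "x = Suc u" "y = Suc v" "u < n" "v < n"
    using assms by (cases x; cases y) auto
  show ?thesis
  proof (cases "u < v")
    case True
    then show ?thesis using that[of "v - u"] uv by (simp add: cyc_pow)
  next
    case False
    then show ?thesis using that[of "n + v - u"] uv by (simp add: cyc_pow)
  qed
qed

lemma ncycles_cyc:
  assumes "n \<ge> 1" shows "ncycles n (cyc n) = 1"
proof -
  have "orb (cyc n) x = {1..n}" if x: "x \<in> {1..n}" for x
  proof
    show "orb (cyc n) x \<subseteq> {1..n}" using x cyc_pow_in by (auto simp: orb_def)
    show "{1..n} \<subseteq> orb (cyc n) x"
      proof
      fix y assume "y \<in> {1..n}"
      with cyc_pow_reach[OF assms x] obtain s where "(cyc n ^^ s) x = y" by blast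
      then show "y \<in> orb (cyc n) x" by (auto simp: orb_def)
    qed
  qed
  then have "orb (cyc n) ` {1..n} = {{1..n}}" using assms by auto
  then show ?thesis by (simp add: ncycles_orb)
qed

section \<open>Minimal prefixes with non-decreasing left endpoints\<close>

lemma tr_apply: "tr g x = (if x = fst g then snd g else if x = snd g then fst g else x)"
  by (simp add: tr_def Transposition.transpose_def)

lemma tr_tr [simp]: "tr g (tr g x) = x"
  by (simp add: tr_def)

lemma tr_permutes: "is_transp n g \<Longrightarrow> tr g permutes {1..n}"
  unfolding tr_def by (rule permutes_swap_id) (auto simp: is_transp_def)

lemma prodT_Nil: "prodT [] = id"
  by (simp add: prodT_def)

lemma prodT_Cons: "prodT (g # ts) = tr g \<circ> prodT ts"
  by (simp add: prodT_def)

lemma prodT_append: "prodT (xs @ ys) = prodT xs \<circ> prodT ys"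
  by (induction xs) (simp_all only: append_Nil append_Cons prodT_Nil prodT_Cons id_comp comp_assoc)

lemma prodT_snoc: "prodT (xs @ [g]) = prodT xs \<circ> tr g"
  by (simp only: prodT_append prodT_Cons prodT_Nil comp_id)

lemma prodT_Nil_apply [simp]: "prodT [] x = x"
  by (simp add: prodT_Nil)

lemma prodT_Cons_apply [simp]: "prodT (g # ts) x = tr g (prodT ts x)"
  by (simp add: prodT_Cons)

lemma prodT_append_apply [simp]: "prodT (xs @ ys) x = prodT xs (prodT ys x)"
  by (simp add: prodT_append)

lemma prodT_permutes: "\<forall>t\<in>set ts. is_transp n t \<Longrightarrow> prodT ts permutes {1..n}"
proof (induction ts)
  case Nil
  show ?case unfolding prodT_Nil by (rule permutes_id)
next
  case (Cons g ts)
  then have "is_transp n g" "\<forall>t\<in>set ts. is_transp n t" by simp_all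
  then show ?case
    unfolding prodT_Cons using permutes_compose[OF Cons.IH tr_permutes] by blast
qed

lemma prodT_rev_apply: "prodT ts (prodT (rev ts) x) = x" "prodT (rev ts) (prodT ts x) = x"
  by (induction ts arbitrary: x) simp_all

lemma inv_prodT: "inv (prodT ts) = prodT (rev ts)"
  by (rule inv_unique_comp) (simp_all add: fun_eq_iff prodT_rev_apply)

lemma prodT_fix:
  assumes "\<And>g. g \<in> set ts \<Longrightarrow> fst g \<noteq> x \<and> snd g \<noteq> x"
  shows "prodT ts x = x"
  using assms
proof (induction ts)
  case (Cons g ts)
  have "prodT ts x = x" by (rule Cons.IH, rule Cons.prems) simp
  moreover have "fst g \<noteq> x \<and> snd g \<noteq> x" by (rule Cons.prems) simp
  ultimately show ?case by (simp add: tr_apply)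
qed simp

lemma tr_stable: "fst g \<in> T \<longleftrightarrow> snd g \<in> T \<Longrightarrow> y \<in> T \<Longrightarrow> tr g y \<in> T"
  unfolding tr_apply by presburger

lemma prodT_stable:
  assumes "\<forall>g\<in>set ts. fst g \<in> T \<longleftrightarrow> snd g \<in> T" "x \<in> T"
  shows "prodT ts x \<in> T"
  using assms(1)
proof (induction ts)
  case (Cons g ts)
  then have "prodT ts x \<in> T" "fst g \<in> T \<longleftrightarrow> snd g \<in> T" by simp_all
  then show ?case unfolding prodT_Cons_apply by (intro tr_stable)
qed (simp add: assms(2))

text \<open>The laminar condition on the intervals \<open>[i, j)\<close> for \<open>g\<close>
  preceding \<open>h\<close>. The strict inequality keeps right endpoints of transpositions
  distinct, as parking spots must be, while left endpoints may repeat.\<close>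

definition nested :: "nat \<times> nat \<Rightarrow> nat \<times> nat \<Rightarrow> bool" where
  "nested g h \<longleftrightarrow> fst g \<le> fst h \<and> (snd g \<le> fst h \<or> snd h < snd g)"

text \<open>The right endpoint of the last factor is new to the product before it. Hence the full
  product sends \<open>fst g\<close> to \<open>snd g\<close>, so that the last factor can be
  recovered from it.\<close>

lemma prodT_nested_fix:
  assumes "is_transp n g" "\<forall>h\<in>set ts. nested h g"
  shows "prodT ts (snd g) = snd g"
proof (rule prodT_fix)
  fix h assume "h \<in> set ts"
  then have "nested h g" using assms by simp
  then show "fst h \<noteq> snd g \<and> snd h \<noteq> snd g"
    using assms(1) by (auto simp: nested_def is_transp_def)
qed

text \<open>The map is the Kreweras complement, the inverse of the product followed on the right by
  the long cycle. After the step to \<open>Suc x\<close>, factors before \<open>g\<close> leave this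
  point alone, \<open>g\<close> returns its right endpoint to its left one, and each later factor
  has both endpoints in the interval or neither.\<close>

lemma kreweras_stable:
  assumes srt: "sorted_wrt nested ts" and tr: "\<forall>t\<in>set ts. is_transp n t"
    and g: "g \<in> set ts" and x: "x \<in> {fst g..<snd g}"
  shows "(prodT (rev ts) \<circ> cyc n) x \<in> {fst g..<snd g}"
proof -
  obtain pre suf where ts: "ts = pre @ g # suf" using g by (meson split_list)
  have pre: "nested h g" "is_transp n h" if "h \<in> set pre" for h
    using srt tr that by (auto simp: ts sorted_wrt_append)
  have suf: "nested g h" "is_transp n h" if "h \<in> set suf" for h
    using srt tr that by (auto simp: ts sorted_wrt_append)
  have gt: "is_transp n g" using tr g by blast
  have "cyc n x = Suc x" using x gt by (auto simp: cyc_def is_transp_def)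
  moreover have "prodT (rev pre) (Suc x) = Suc x"
  proof (rule prodT_fix)
    fix h assume "h \<in> set (rev pre)"
    then have "nested h g" using pre(1) by simp
    then show "fst h \<noteq> Suc x \<and> snd h \<noteq> Suc x" using x by (auto simp: nested_def)
  qed
  moreover have "tr g (Suc x) \<in> {fst g..<snd g}"
    using x by (auto simp: tr_apply)
  then have "prodT (rev suf) (tr g (Suc x)) \<in> {fst g..<snd g}"
  proof (intro prodT_stable ballI)
    fix h assume "h \<in> set (rev suf)"
    then have "nested g h" "is_transp n h" using suf by simp_all
    then show "fst h \<in> {fst g..<snd g} \<longleftrightarrow> snd h \<in> {fst g..<snd g}"
      by (auto simp: nested_def is_transp_def)
  qed
  ultimately show ?thesis by (simp add: ts)
qed

lemma kreweras_orb:
  assumes "sorted_wrt nested ts" "\<forall>t\<in>set ts. is_transp n t" "g \<in> set ts"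
    and eq: "orb (prodT (rev ts) \<circ> cyc n) x = orb (prodT (rev ts) \<circ> cyc n) y"
    and x: "x \<in> {fst g..<snd g}"
  shows "y \<in> {fst g..<snd g}"
proof -
  have "orb (prodT (rev ts) \<circ> cyc n) x \<subseteq> {fst g..<snd g}"
    by (rule orb_subset[OF _ x]) (rule kreweras_stable[OF assms(1-3)])
  then show ?thesis using orb_self[of y "prodT (rev ts) \<circ> cyc n"] unfolding eq by blast
qed

lemma kreweras_permutes:
  assumes "n \<ge> 1" "\<forall>t\<in>set ts. is_transp n t"
  shows "prodT (rev ts) \<circ> cyc n permutes {1..n}"
  by (rule permutes_compose[OF cyc_permutes prodT_permutes]) (use assms in auto)

lemma kreweras_snoc: "prodT (rev (ts @ [g])) \<circ> cyc n = tr g \<circ> (prodT (rev ts) \<circ> cyc n)"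
  by (rule ext) simp

text \<open>Start from the single cycle of \<open>cyc n\<close>; each factor adds at most
  one.\<close>

lemma ncycles_kreweras_le:
  assumes "n \<ge> 1" "\<forall>t\<in>set ts. is_transp n t"
  shows "ncycles n (prodT (rev ts) \<circ> cyc n) \<le> length ts + 1"
  using assms(2)
proof (induction ts rule: rev_induct)
  case Nil
  then show ?case unfolding rev.simps prodT_Nil id_comp using ncycles_cyc[OF assms(1)] by simp
next
  case (snoc g ts)
  have "ncycles n (tr g \<circ> (prodT (rev ts) \<circ> cyc n)) \<le> ncycles n (prodT (rev ts) \<circ> cyc n) + 1"
    unfolding tr_def
    by (rule ncycles_transpose_comp_le[OF kreweras_permutes[OF assms(1)]])
       (use snoc.prems in \<open>auto simp: is_transp_def\<close>)
  then show ?case using snoc unfolding kreweras_snoc by (simp del: comp_apply)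
qed

text \<open>For the lower bound, \<open>k + 1\<close> points are placed in distinct cycles: the last
  point \<open>snd g - 1\<close> of each interval, and \<open>n\<close>, which no half-open interval
  contains. If \<open>g\<close> precedes \<open>h\<close>, the interval of \<open>h\<close> misses
  \<open>snd g - 1\<close>, and stability separates the cycles.\<close>

lemma ncycles_kreweras_nested:
  assumes "n \<ge> 1" "\<forall>t\<in>set ts. is_transp n t" "sorted_wrt nested ts"
  shows "ncycles n (prodT (rev ts) \<circ> cyc n) = length ts + 1"
proof (rule antisym[OF ncycles_kreweras_le[OF assms(1,2)]])
  define d where "d = prodT (rev ts) \<circ> cyc n"
  define e where "e g = orb d (snd g - 1)" for g :: "nat \<times> nat"
  have last: "snd g - 1 \<in> {fst g..<snd g}" if "g \<in> set ts" for g
    using assms(2) that by (auto simp: is_transp_def)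
  have neq: "e g \<noteq> e h" if gh: "g \<in> set ts" "h \<in> set ts" "nested g h" for g h
  proof
    assume "e g = e h"
    then have "snd g - 1 \<in> {fst h..<snd h}"
      using kreweras_orb[OF assms(3,2) gh(2) _ last[OF gh(2)]] by (simp add: e_def d_def)
    moreover have "is_transp n g" "is_transp n h" using gh assms(2) by auto
    ultimately show False using gh(3) by (auto simp: nested_def is_transp_def)
  qed
  have "sorted_wrt (\<lambda>g h. e g \<noteq> e h) ts"
    using neq by (auto intro: sorted_wrt_mono_rel[OF _ assms(3)])
  then have dist: "distinct (map e ts)"
    by (induction ts) auto
  have notin: "orb d n \<notin> e ` set ts"
  proof
    assume "orb d n \<in> e ` set ts"
    then obtain g where g: "g \<in> set ts" "e g = orb d n" by force
    then have "n \<in> {fst g..<snd g}"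
      using kreweras_orb[OF assms(3,2) g(1) _ last[OF g(1)]] by (simp add: e_def d_def)
    then show False using g assms(2) by (auto simp: is_transp_def)
  qed
  have "length ts + 1 = card (insert (orb d n) (e ` set ts))"
    using notin distinct_card[OF dist] by simp
  also have "\<dots> \<le> card (orb d ` {1..n})"
  proof (rule card_mono)
    have "snd g - 1 \<in> {1..n}" if "g \<in> set ts" for g
      using assms(2) that by (auto simp: is_transp_def)
    then show "insert (orb d n) (e ` set ts) \<subseteq> orb d ` {1..n}"
      using assms(1) unfolding e_def by auto
  qed simp
  finally show "length ts + 1 \<le> ncycles n (prodT (rev ts) \<circ> cyc n)"
    by (simp add: ncycles_orb d_def)
qed

text \<open>Each new right endpoint is a fixed point of the product so far, so every factor removes
  exactly one of the \<open>n\<close> cycles of the identity.\<close>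

lemma ncycles_prodT_nested:
  assumes "\<forall>t\<in>set ts. is_transp n t" "sorted_wrt nested ts"
  shows "ncycles n (prodT ts) + length ts = n"
  using assms
proof (induction ts rule: rev_induct)
  case Nil
  show ?case by (simp only: prodT_Nil ncycles_id list.size add_0_right)
next
  case (snoc g ts)
  have fixp: "prodT ts (snd g) = snd g"
    by (rule prodT_nested_fix) (use snoc.prems in \<open>auto simp: sorted_wrt_append\<close>)
  have "ncycles n (prodT ts \<circ> tr g) + 1 = ncycles n (prodT ts)"
    unfolding tr_def
    by (rule ncycles_comp_transpose_fixpoint[OF prodT_permutes])
       (use snoc.prems fixp in \<open>auto simp: is_transp_def\<close>)
  then show ?case using snoc unfolding prodT_snoc by (simp add: sorted_wrt_append del: comp_apply)
qed

section \<open>Sorted minimal prefixes as nested families\<close>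

lemma Sigma_iff:
  assumes "n \<ge> 1"
  shows "ts \<in> Defs.Sigma n k \<longleftrightarrow> length ts = k \<and> (\<forall>t\<in>set ts. is_transp n t)
    \<and> n - ncycles n (prodT ts) = k \<and> n - 1 = k + (n - ncycles n (prodT (rev ts) \<circ> cyc n))"
  unfolding Defs.Sigma_def prec_def plen_def inv_prodT ncycles_cyc[OF assms] by auto

lemma nested_in_Sigma:
  assumes "n \<ge> 1" "\<forall>t\<in>set ts. is_transp n t" "sorted_wrt nested ts"
  shows "ts \<in> Defs.Sigma n (length ts)"
proof -
  let ?d = "prodT (rev ts) \<circ> cyc n"
  have "ncycles n (prodT ts) + length ts = n" "ncycles n ?d = length ts + 1" "ncycles n ?d \<le> n"
    using ncycles_prodT_nested[OF assms(2,3)] ncycles_kreweras_nested[OF assms] ncycles_le by blast+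
  then have "n - ncycles n (prodT ts) = length ts" "n - 1 = length ts + (n - ncycles n ?d)"
    by linarith+
  then show ?thesis unfolding Sigma_iff[OF assms(1)] using assms(2) by blast
qed

text \<open>Each factor of a minimal prefix has to split a cycle, so its two endpoints lie in a common
  cycle; as the earlier half-open intervals are stable, neither of them separates the endpoints.\<close>

lemma nested_if_ncycles_kreweras:
  assumes "n \<ge> 1" "\<forall>t\<in>set ts. is_transp n t" "sorted (map fst ts)"
    and "ncycles n (prodT (rev ts) \<circ> cyc n) = length ts + 1"
  shows "sorted_wrt nested ts"
  using assms(2-)
proof (induction ts rule: rev_induct)
  case (snoc g ts)
  define d where "d = prodT (rev ts) \<circ> cyc n"
  have tr: "\<forall>t\<in>set ts. is_transp n t" and g: "is_transp n g" using snoc.prems by auto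
  have fst_le: "fst h \<le> fst g" if "h \<in> set ts" for h
    using snoc.prems(2) that by (auto simp: sorted_append)
  have ab: "fst g \<in> {1..n}" "snd g \<in> {1..n}" using g by (auto simp: is_transp_def)
  have eq: "ncycles n (Transposition.transpose (fst g) (snd g) \<circ> d) = length ts + 2"
    using snoc.prems(3) unfolding kreweras_snoc d_def tr_def by (simp del: comp_apply)
  have d: "d permutes {1..n}" unfolding d_def by (rule kreweras_permutes[OF assms(1) tr])
  have le: "ncycles n d \<le> length ts + 1"
    unfolding d_def by (rule ncycles_kreweras_le[OF assms(1) tr])
  then have "ncycles n d = length ts + 1"
    using ncycles_transpose_comp_le[OF d ab] eq by linarith
  moreover have "sorted (map fst ts)" using snoc.prems(2) by (simp add: sorted_append)
  ultimately have IH: "sorted_wrt nested ts"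
    using tr unfolding d_def by (intro snoc.IH)
  have same: "orb d (fst g) = orb d (snd g)"
    using ncycles_transpose_comp_merge[OF d ab] eq le by linarith
  have "nested h g" if h: "h \<in> set ts" for h
  proof (cases "snd h \<le> fst g")
    case False
    then have "snd g \<in> {fst h..<snd h}"
      using kreweras_orb[OF IH tr h same[unfolded d_def]] fst_le[OF h] by simp
    then show ?thesis using fst_le[OF h] by (auto simp: nested_def)
  qed (use fst_le[OF h] in \<open>simp add: nested_def\<close>)
  then show ?case using IH by (simp add: sorted_wrt_append)
qed simp

lemma Sigma_is_transp: "ts \<in> Defs.Sigma n k \<Longrightarrow> \<forall>t\<in>set ts. is_transp n t"
  by (simp add: Defs.Sigma_def)

lemma sorted_in_Sigma_nested:
  assumes n: "n \<ge> 1" and ts: "ts \<in> Defs.Sigma n k" and "sorted (map fst ts)"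
  shows "sorted_wrt nested ts"
proof (rule nested_if_ncycles_kreweras[OF n Sigma_is_transp[OF ts] assms(3)])
  let ?d = "prodT (rev ts) \<circ> cyc n"
  have "length ts = k" "n - 1 = k + (n - ncycles n ?d)" "ncycles n ?d \<le> length ts + 1"
    "ncycles n ?d \<le> n"
    using ts ncycles_kreweras_le[OF n Sigma_is_transp[OF ts]] ncycles_le
    unfolding Sigma_iff[OF n] by blast+
  then show "ncycles n ?d = length ts + 1" using n by linarith
qed

text \<open>Factors are peeled off from the right: the product maps the known left endpoint of the
  last factor to its right endpoint, which identifies the factor, and it can then be
  cancelled.\<close>

lemma nested_unique:
  assumes "sorted_wrt nested ts" "sorted_wrt nested us"
    and "\<forall>t\<in>set ts. is_transp n t" "\<forall>t\<in>set us. is_transp n t"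
    and "map fst ts = map fst us" "prodT ts = prodT us"
  shows "ts = us"
  using assms
proof (induction ts arbitrary: us rule: rev_induct)
  case (snoc g ts)
  have last: "prodT (vs @ [h]) (fst h) = snd h"
    if "sorted_wrt nested (vs @ [h])" "\<forall>t\<in>set (vs @ [h]). is_transp n t" for vs h
  proof -
    have "prodT vs (snd h) = snd h"
      by (rule prodT_nested_fix) (use that in \<open>auto simp: sorted_wrt_append\<close>)
    then show ?thesis by (simp add: tr_apply)
  qed
  obtain vs h where us: "us = vs @ [h]" using snoc.prems(5) by (cases us rule: rev_cases) auto
  have "fst g = fst h" "map fst ts = map fst vs" using snoc.prems(5) us by auto
  then have gh: "g = h"
    using last[OF snoc.prems(1,3)] last[OF snoc.prems(2,4)[unfolded us]] snoc.prems(6)[unfolded us]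
    by (simp add: prod_eq_iff del: prodT_append_apply)
  have cancel: "prodT ws \<circ> tr h \<circ> tr h = prodT ws" for ws by (rule ext) simp
  have "prodT ts \<circ> tr h = prodT vs \<circ> tr h"
    using snoc.prems(6) unfolding us gh prodT_snoc .
  then have "prodT ts = prodT vs" using cancel by metis
  then have "ts = vs"
    using snoc.prems us \<open>map fst ts = map fst vs\<close> by (intro snoc.IH) (auto simp: sorted_wrt_append)
  then show ?case using gh us by simp
qed simp

section \<open>The symmetric group action on minimal prefixes\<close>

text \<open>\<open>g\<close> moves neither \<open>fst h\<close> nor any point below
  \<open>fst g\<close>, and the image of \<open>snd h\<close> stays to the right of
  \<open>fst h\<close>; this decides the minimum and maximum in \<open>conjT\<close>.\<close>

lemma conjT_eq:
  assumes "is_transp n g" "is_transp n h" "fst h < fst g"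
  shows "conjT g h = (fst h, tr g (snd h))"
  using assms by (auto simp: conjT_def Let_def tr_apply is_transp_def)

lemma is_transp_conjT:
  assumes "is_transp n g" "is_transp n h" "fst h < fst g"
  shows "is_transp n (conjT g h)"
  unfolding conjT_eq[OF assms] using assms by (auto simp: tr_apply is_transp_def)

lemma tr_conjT:
  assumes "is_transp n g" "is_transp n h" "fst h < fst g"
  shows "tr (conjT g h) x = tr g (tr h (tr g x))"
  unfolding conjT_eq[OF assms] using assms by (auto simp: tr_apply is_transp_def)

lemma conjT_conjT:
  assumes "is_transp n g" "is_transp n h" "fst h < fst g"
  shows "conjT g (conjT g h) = h"
proof -
  have "fst (conjT g h) < fst g" using assms by (simp add: conjT_eq)
  from conjT_eq[OF assms(1) is_transp_conjT[OF assms] this] show ?thesis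
    by (simp add: conjT_eq[OF assms])
qed

text \<open>A Hurwitz move freed from list indices. The conjugated factor is always the one with the
  smaller left endpoint, which by \<open>conjT_eq\<close> keeps that endpoint; this is why the move
  permutes left endpoints.\<close>

definition hpair :: "nat \<times> nat \<Rightarrow> nat \<times> nat \<Rightarrow> (nat \<times> nat) \<times> (nat \<times> nat)" where
  "hpair g h = (if fst g = fst h then (g, h)
     else if fst g < fst h then (h, conjT h g) else (conjT g h, g))"

lemma hgen_append:
  "hgen (Suc (length xs)) (xs @ g # h # zs)
    = xs @ fst (hpair g h) # snd (hpair g h) # zs"
  by (simp add: hgen_def hpair_def Let_def nth_append list_update_append)

lemma hpair_props:
  assumes "is_transp n g" "is_transp n h"
  shows "is_transp n (fst (hpair g h))" "is_transp n (snd (hpair g h))"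
    "fst (fst (hpair g h)) = fst h" "fst (snd (hpair g h)) = fst g"
    "tr (fst (hpair g h)) (tr (snd (hpair g h)) x) = tr g (tr h x)"
    "hpair (fst (hpair g h)) (snd (hpair g h)) = (g, h)"
proof -
  consider "fst g = fst h" | "fst g < fst h" | "fst h < fst g" by linarith
  note cs = this
  show "is_transp n (fst (hpair g h))" "is_transp n (snd (hpair g h))"
    by (cases rule: cs; simp add: hpair_def assms is_transp_conjT[OF assms]
        is_transp_conjT[OF assms(2,1)])+
  show "fst (fst (hpair g h)) = fst h" "fst (snd (hpair g h)) = fst g"
    by (cases rule: cs; simp add: hpair_def conjT_eq[OF assms] conjT_eq[OF assms(2,1)])+
  show "tr (fst (hpair g h)) (tr (snd (hpair g h)) x) = tr g (tr h x)"
    by (cases rule: cs; simp add: hpair_def tr_conjT[OF assms] tr_conjT[OF assms(2,1)])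
  show "hpair (fst (hpair g h)) (snd (hpair g h)) = (g, h)"
  proof (cases rule: cs)
    case 1
    then show ?thesis by (simp add: hpair_def)
  next
    case 2
    then have e: "hpair g h = (h, conjT h g)" by (simp add: hpair_def)
    have "fst (conjT h g) < fst h" using 2 by (simp add: conjT_eq[OF assms(2,1)])
    then have "hpair h (conjT h g) = (conjT h (conjT h g), h)" by (simp add: hpair_def)
    then show ?thesis unfolding e fst_conv snd_conv conjT_conjT[OF assms(2,1) 2] .
  next
    case 3
    then have e: "hpair g h = (conjT g h, g)" by (simp add: hpair_def)
    have "fst (conjT g h) < fst g" using 3 by (simp add: conjT_eq[OF assms])
    then have "hpair (conjT g h) g = (g, conjT g (conjT g h))" by (simp add: hpair_def)
    then show ?thesis unfolding e fst_conv snd_conv conjT_conjT[OF assms 3] .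
  qed
qed

lemma split_two:
  assumes "l \<in> {1..<length ts}"
  obtains xs g h zs where "ts = xs @ g # h # zs" "l = Suc (length xs)"
proof -
  have "ts = take (l - 1) ts @ drop (l - 1) ts" by simp
  also have "drop (l - 1) ts = ts ! (l - 1) # drop l ts"
  proof -
    have "l - 1 < length ts" "Suc (l - 1) = l" using assms by auto
    then show ?thesis using Cons_nth_drop_Suc[of "l - 1" ts] by simp
  qed
  also have "drop l ts = ts ! l # drop (Suc l) ts"
    using assms Cons_nth_drop_Suc[of l ts] by simp
  finally have "ts = take (l - 1) ts @ ts ! (l - 1) # ts ! l # drop (Suc l) ts" .
  moreover have "l = Suc (length (take (l - 1) ts))" using assms by auto
  ultimately show ?thesis by (rule that)
qed

lemma seq_act_nth: "i < length xs \<Longrightarrow> seq_act p xs ! i = xs ! (inv p (Suc i) - 1)"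
  by (simp add: seq_act_def)

lemma seq_act_adjacent:
  "seq_act (Transposition.transpose (Suc (length xs)) (Suc (Suc (length xs)))) (xs @ a # b # zs)
    = xs @ b # a # zs"
proof (rule nth_equalityI)
  define t where "t = Transposition.transpose (Suc (length xs)) (Suc (Suc (length xs)))"
  fix i assume "i < length (seq_act (Transposition.transpose (Suc (length xs)) (Suc (Suc (length xs))))
    (xs @ a # b # zs))"
  then have i: "i < length (xs @ a # b # zs)" by (simp add: seq_act_def)
  have inv_t: "inv t = t" by (simp add: t_def)
  have "(xs @ a # b # zs) ! (t (Suc i) - 1) = (xs @ b # a # zs) ! i"
  proof (cases "i = length xs \<or> i = Suc (length xs)")
    case True
    then show ?thesis by (auto simp: t_def nth_append)
  next
    case False
    then have "t (Suc i) = Suc i" by (simp add: t_def Transposition.transpose_def)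
    moreover have "(a # b # zs) ! (i - length xs) = (b # a # zs) ! (i - length xs)"
      if "\<not> i < length xs"
      using that False by (auto simp: nth_Cons split: nat.splits)
    ultimately show ?thesis by (simp add: nth_append)
  qed
  then show "seq_act (Transposition.transpose (Suc (length xs)) (Suc (Suc (length xs))))
      (xs @ a # b # zs) ! i = (xs @ b # a # zs) ! i"
    unfolding t_def[symmetric] seq_act_nth[OF i] inv_t .
qed (simp add: seq_act_def)

lemma hgen_props:
  assumes "l \<in> {1..<length ts}" "\<forall>t\<in>set ts. is_transp n t"
  shows "length (hgen l ts) = length ts" "\<forall>t\<in>set (hgen l ts). is_transp n t"
    "prodT (hgen l ts) = prodT ts" "hgen l (hgen l ts) = ts"
    "map fst (hgen l ts) = seq_act (Transposition.transpose l (l + 1)) (map fst ts)"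
proof -
  obtain xs g h zs where ts: "ts = xs @ g # h # zs" and l: "l = Suc (length xs)"
    using assms(1) by (rule split_two)
  have gh: "is_transp n g" "is_transp n h" using assms(2) ts by auto
  note hp = hpair_props[OF gh]
  have hg: "hgen l ts = xs @ fst (hpair g h) # snd (hpair g h) # zs"
    unfolding ts l by (rule hgen_append)
  show "length (hgen l ts) = length ts" unfolding hg unfolding ts by simp
  show "\<forall>t\<in>set (hgen l ts). is_transp n t" using assms(2) hp(1,2) unfolding hg unfolding ts by auto
  show "prodT (hgen l ts) = prodT ts" unfolding hg unfolding ts by (rule ext) (simp add: hp(5))
  show "hgen l (hgen l ts) = ts" unfolding hg unfolding l hgen_append hp(6) ts by simp
  have "l + 1 = Suc (Suc (length (map fst xs)))" "l = Suc (length (map fst xs))"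
    using l by simp_all
  then show "map fst (hgen l ts) = seq_act (Transposition.transpose l (l + 1)) (map fst ts)"
    unfolding hg unfolding ts by (simp add: hp(3,4) seq_act_adjacent del: length_map)
qed

section \<open>Words in the adjacent transpositions\<close>

lemma perm_of_word_Nil: "perm_of_word [] = id"
  by (simp add: perm_of_word_def)

lemma perm_of_word_Cons: "perm_of_word (l # ws) = Transposition.transpose l (l + 1) \<circ> perm_of_word ws"
  by (simp add: perm_of_word_def)

lemma perm_of_word_append: "perm_of_word (vs @ ws) = perm_of_word vs \<circ> perm_of_word ws"
  by (induction vs) (simp_all only: append_Nil append_Cons perm_of_word_Nil perm_of_word_Cons
      id_comp comp_assoc)

lemma perm_of_word_permutes: "set ws \<subseteq> {1..<k} \<Longrightarrow> perm_of_word ws permutes {1..k}"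
proof (induction ws)
  case Nil
  show ?case unfolding perm_of_word_Nil by (rule permutes_id)
next
  case (Cons l ws)
  have "Transposition.transpose l (l + 1) permutes {1..k}"
    by (rule permutes_swap_id) (use Cons.prems in auto)
  moreover have "perm_of_word ws permutes {1..k}" using Cons by simp
  ultimately show ?case unfolding perm_of_word_Cons by (rule permutes_compose[rotated])
qed


lemma word_of_transposition:
  assumes "1 \<le> a" "Suc (a + d) \<le> k"
  shows "\<exists>ws. set ws \<subseteq> {1..<k} \<and> perm_of_word ws = Transposition.transpose a (Suc (a + d))"
  using assms(2)
proof (induction d)
  case 0
  have "perm_of_word [a] = Transposition.transpose a (Suc (a + 0))"
    by (simp add: perm_of_word_def)
  then show ?case using assms(1) 0 by (intro exI[of _ "[a]"]) simp
next
  case (Suc d)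
  define b where "b = Suc (a + d)"
  obtain ws where ws: "set ws \<subseteq> {1..<k}" "perm_of_word ws = Transposition.transpose a b"
    using Suc unfolding b_def by auto
  \<comment> \<open>Conjugating the transposition of \<open>a\<close> and \<open>b\<close> by that
    of \<open>b\<close> and \<open>Suc b\<close> moves the right end one place further.\<close>
  have "perm_of_word ([b] @ ws @ [b]) = Transposition.transpose a (Suc b)"
    unfolding perm_of_word_append ws(2)
    by (rule ext) (auto simp: perm_of_word_def Transposition.transpose_def b_def)
  moreover have "set ([b] @ ws @ [b]) \<subseteq> {1..<k}" using ws(1) Suc.prems by (auto simp: b_def)
  ultimately show ?case unfolding b_def by (metis add_Suc_right)
qed

lemma ex_perm_of_word:
  assumes "p permutes {1..k}"
  shows "\<exists>ws. set ws \<subseteq> {1..<k} \<and> perm_of_word ws = p"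
  using assms finite_atLeastAtMost
proof (induction p rule: permutes_induct)
  case id
  show ?case by (intro exI[of _ "[]"]) (simp add: perm_of_word_Nil)
next
  case (swap a b p)
  obtain ws where ws: "set ws \<subseteq> {1..<k}" "perm_of_word ws = p" using swap.IH by blast
  have "\<exists>vs. set vs \<subseteq> {1..<k} \<and> perm_of_word vs = Transposition.transpose a b"
  proof (cases "a < b")
    case True
    then obtain d where "b = Suc (a + d)" using less_imp_Suc_add by blast
    then show ?thesis using word_of_transposition[of a d k] swap by auto
  next
    case False
    then obtain d where "a = Suc (b + d)" using less_imp_Suc_add swap by (metis linorder_neqE_nat)
    then show ?thesis using word_of_transposition[of b d k] swap
      by (auto simp: Transposition.transpose_commute)
  qed
  then obtain vs where vs: "set vs \<subseteq> {1..<k}" "perm_of_word vs = Transposition.transpose a b"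
    by blast
  have "perm_of_word (vs @ ws) = Transposition.transpose a b \<circ> p"
    unfolding perm_of_word_append vs(2) ws(2) ..
  then show ?case using vs(1) ws(1) by (intro exI[of _ "vs @ ws"]) auto
qed

lemma seq_act_comp:
  assumes "p permutes {1..length xs}" "q permutes {1..length xs}"
  shows "seq_act (p \<circ> q) xs = seq_act p (seq_act q xs)"
proof (rule nth_equalityI)
  fix i assume "i < length (seq_act (p \<circ> q) xs)"
  then have i: "i < length xs" by (simp add: seq_act_def)
  have "inv p (i + 1) \<in> {1..length xs}"
    using permutes_in_image[OF permutes_inv[OF assms(1)], of "i + 1"] i by simp
  then obtain m where m: "inv p (Suc i) = Suc m" "m < length xs"
    by (cases "inv p (Suc i)") auto
  have "inv (p \<circ> q) = inv q \<circ> inv p"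
    using assms by (intro o_inv_distrib) (auto intro: permutes_bij)
  then show "seq_act (p \<circ> q) xs ! i = seq_act p (seq_act q xs) ! i"
    using i m by (simp add: seq_act_def)
qed (simp add: seq_act_def)

lemma seq_act_id: "seq_act id xs = xs"
  by (simp add: seq_act_def inv_id map_nth)

lemma ex_seq_act_sort: "\<exists>s. s permutes {1..length xs} \<and> seq_act s xs = sort xs"
proof -
  obtain p where p: "p permutes {..<length xs}" "permute_list p xs = sort xs"
    using mset_eq_permutation[of "sort xs" xs] by auto
  \<comment> \<open>\<open>p\<close> acts on the indices \<open>0..<k\<close>; \<open>q\<close> is
    its transport along \<open>Suc\<close> to \<open>1..k\<close>. Its inverse is the permutation
    wanted, because \<open>seq_act\<close> reads positions through \<open>inv\<close>.\<close>
  define q where "q x = (if x \<in> {1..length xs} then Suc (p (inv_into {..<length xs} Suc x)) else x)" for x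
  have "bij_betw Suc {..<length xs} {1..length xs}"
    by (auto simp: bij_betw_def image_Suc_lessThan)
  then have q: "q permutes {1..length xs}"
    unfolding q_def using permutes_bij_inv_into[OF p(1)] by blast
  have q_Suc: "q (Suc i) = Suc (p i)" if "i < length xs" for i
    using that inv_into_f_f[of Suc "{..<length xs}" i] by (simp add: q_def)
  have "inv (inv q) = q" using q by (rule permutes_inv_inv)
  then have "seq_act (inv q) xs = permute_list p xs"
    by (auto simp: seq_act_def permute_list_def q_Suc)
  then show ?thesis using p(2) permutes_inv[OF q] by auto
qed

lemma apply_word_Cons: "apply_word (l # ws) ts = hgen l (apply_word ws ts)"
  by (simp add: apply_word_def)

lemma apply_word_append: "apply_word (vs @ ws) ts = apply_word vs (apply_word ws ts)"
  by (simp add: apply_word_def)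

text \<open>The last conjunct holds because the generators are involutions. It makes the action of a
  fixed word injective, so that equality of tuples can be tested after sorting.\<close>

lemma apply_word_props:
  assumes "\<forall>t\<in>set ts. is_transp n t" "set ws \<subseteq> {1..<length ts}"
  shows "length (apply_word ws ts) = length ts \<and> (\<forall>t\<in>set (apply_word ws ts). is_transp n t)
    \<and> prodT (apply_word ws ts) = prodT ts
    \<and> map fst (apply_word ws ts) = seq_act (perm_of_word ws) (map fst ts)
    \<and> apply_word (rev ws) (apply_word ws ts) = ts"
  using assms(2)
proof (induction ws)
  case Nil
  have "seq_act (perm_of_word []) (map fst ts) = map fst ts"
    unfolding perm_of_word_Nil by (rule seq_act_id)
  then show ?case using assms(1) by (simp add: apply_word_def)
next
  case (Cons l ws)
  define us where "us = apply_word ws ts"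
  have IH: "length us = length ts" "\<forall>t\<in>set us. is_transp n t" "prodT us = prodT ts"
    "map fst us = seq_act (perm_of_word ws) (map fst ts)" "apply_word (rev ws) us = ts"
    using Cons unfolding us_def by auto
  have l: "l \<in> {1..<length us}" using Cons.prems IH(1) by simp
  note h = hgen_props[OF l IH(2)]
  have "map fst (hgen l us) = seq_act (perm_of_word (l # ws)) (map fst ts)"
    unfolding h(5) IH(4) perm_of_word_Cons
    by (rule seq_act_comp[symmetric]; simp only: length_map)
       (use Cons.prems in \<open>auto intro!: permutes_swap_id perm_of_word_permutes simp del: One_nat_def\<close>)
  moreover have "apply_word (rev (l # ws)) (hgen l us) = ts"
    using h(4) IH(5) by (simp add: apply_word_append apply_word_def)
  ultimately show ?case using h(1-3) IH(1,3) by (simp add: apply_word_Cons us_def)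
qed

section \<open>The action on minimal prefixes\<close>

lemma Sigma_prodT:
  assumes "ts \<in> Defs.Sigma n k" "prodT us = prodT ts" "length us = k" "\<forall>t\<in>set us. is_transp n t"
  shows "us \<in> Defs.Sigma n k"
  using assms by (simp add: Defs.Sigma_def)

lemma apply_word_Sigma:
  assumes "ts \<in> Defs.Sigma n k" "set ws \<subseteq> {1..<k}"
  shows "apply_word ws ts \<in> Defs.Sigma n k"
proof -
  have len: "length ts = k" using assms(1) by (simp add: Defs.Sigma_def)
  show ?thesis
    using apply_word_props[OF Sigma_is_transp[OF assms(1)], of ws] assms
    unfolding len by (intro Sigma_prodT[OF assms(1)]) auto
qed

lemma act_props:
  assumes ts: "ts \<in> Defs.Sigma n k" and p: "p permutes {1..k}"
  shows "act p ts \<in> Defs.Sigma n k" "map fst (act p ts) = seq_act p (map fst ts)"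
    "prodT (act p ts) = prodT ts"
proof -
  have len: "length ts = k" using ts by (simp add: Defs.Sigma_def)
  \<comment> \<open>The word chosen by \<open>act\<close> is unknown, but its effect on left
    endpoints and product depends on \<open>p\<close> alone.\<close>
  define ws where "ws = (SOME ws. set ws \<subseteq> {1..<length ts} \<and> perm_of_word ws = p)"
  have ws: "set ws \<subseteq> {1..<length ts} \<and> perm_of_word ws = p"
    unfolding ws_def using ex_perm_of_word[OF p] unfolding len by (rule someI_ex)
  have act: "act p ts = apply_word ws ts" by (simp add: act_def ws_def)
  show "act p ts \<in> Defs.Sigma n k"
    unfolding act using apply_word_Sigma[OF ts] ws len by blast
  show "map fst (act p ts) = seq_act p (map fst ts)" "prodT (act p ts) = prodT ts"
    unfolding act using apply_word_props[OF Sigma_is_transp[OF ts], of ws] ws by auto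
qed

text \<open>A word moves left endpoints without regard to the right ones, so one word sorts all
  prefixes that share their left endpoints. The last clause allows two such prefixes to be sorted
  simultaneously.\<close>

lemma Sigma_sort:
  assumes ts: "ts \<in> Defs.Sigma n k"
  obtains ws where "set ws \<subseteq> {1..<k}" "map fst (apply_word ws ts) = sort (map fst ts)"
    "\<And>us. us \<in> Defs.Sigma n k \<Longrightarrow> map fst us = map fst ts
      \<Longrightarrow> map fst (apply_word ws us) = sort (map fst ts)"
proof -
  have len: "length us = k" if "us \<in> Defs.Sigma n k" for us using that by (simp add: Defs.Sigma_def)
  obtain s where s: "s permutes {1..k}" "seq_act s (map fst ts) = sort (map fst ts)"
    using ex_seq_act_sort[of "map fst ts"] len[OF ts] by auto
  obtain ws where ws: "set ws \<subseteq> {1..<k}" "perm_of_word ws = s"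
    using ex_perm_of_word[OF s(1)] by blast
  have "map fst (apply_word ws us) = sort (map fst ts)"
    if us: "us \<in> Defs.Sigma n k" "map fst us = map fst ts" for us
    using apply_word_props[OF Sigma_is_transp[OF us(1)], of ws] ws s(2) us(2) len[OF us(1)] by simp
  with ts ws(1) show ?thesis using that by blast
qed

text \<open>This replaces the verification of the braid relations: the generators only permute the left
  endpoints and preserve the product, so any two words for the same permutation act alike.\<close>

lemma Sigma_unique:
  assumes n: "n \<ge> 1" and ts: "ts \<in> Defs.Sigma n k" and us: "us \<in> Defs.Sigma n k"
    and fst_eq: "map fst ts = map fst us" and prod_eq: "prodT ts = prodT us"
  shows "ts = us"
proof -
  have len: "length ts = k" "length us = k" using ts us by (auto simp: Defs.Sigma_def)
  obtain ws where ws: "set ws \<subseteq> {1..<k}" and srt: "map fst (apply_word ws ts) = sort (map fst ts)"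
    and srt': "map fst (apply_word ws us) = sort (map fst ts)"
    using Sigma_sort[OF ts] us fst_eq by metis
  note pt = apply_word_props[OF Sigma_is_transp[OF ts], of ws, unfolded len, OF ws]
  note pu = apply_word_props[OF Sigma_is_transp[OF us], of ws, unfolded len, OF ws]
  have "apply_word ws ts = apply_word ws us"
  proof (rule nested_unique[where n = n])
    show "sorted_wrt nested (apply_word ws ts)"
      by (rule sorted_in_Sigma_nested[OF n apply_word_Sigma[OF ts ws]]) (simp add: srt)
    show "sorted_wrt nested (apply_word ws us)"
      by (rule sorted_in_Sigma_nested[OF n apply_word_Sigma[OF us ws]]) (simp add: srt')
    show "map fst (apply_word ws ts) = map fst (apply_word ws us)" by (simp only: srt srt')
  qed (use pt pu prod_eq in simp_all)
  then show ?thesis using pt pu by metis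
qed

section \<open>The parking process\<close>

text \<open>A single parking step, with the free set as a parameter: exchanging two cars means
  comparing the same step for different free sets.\<close>

definition nxt :: "nat \<Rightarrow> nat set \<Rightarrow> nat \<Rightarrow> nat" where
  "nxt n F e = (cyc n ^^ (LEAST s. 1 \<le> s \<and> s \<le> n \<and> (cyc n ^^ s) e \<in> F)) e"

lemma parking_Cons:
  "parking n Os (e # es) = nxt n (Os - set (parking n Os es)) e # parking n Os es"
  by (simp add: nxt_def Let_def)

declare parking.simps(2) [simp del]

lemma nxt_eqI:
  assumes "1 \<le> s" "s \<le> n" "(cyc n ^^ s) e \<in> F"
    and "\<And>t. 1 \<le> t \<Longrightarrow> t < s \<Longrightarrow> (cyc n ^^ t) e \<notin> F"
  shows "nxt n F e = (cyc n ^^ s) e"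
proof -
  have "(LEAST s. 1 \<le> s \<and> s \<le> n \<and> (cyc n ^^ s) e \<in> F) = s"
    by (rule Least_equality) (use assms not_le in blast)+
  then show ?thesis by (simp add: nxt_def)
qed

lemma nxt_obtain:
  assumes "n \<ge> 1" "e \<in> {1..n}" "F \<subseteq> {1..n}" "F \<noteq> {}"
  obtains s where "1 \<le> s" "s \<le> n" "(cyc n ^^ s) e \<in> F" "nxt n F e = (cyc n ^^ s) e"
    "\<And>t. 1 \<le> t \<Longrightarrow> t < s \<Longrightarrow> (cyc n ^^ t) e \<notin> F"
proof -
  define P where "P s \<longleftrightarrow> 1 \<le> s \<and> s \<le> n \<and> (cyc n ^^ s) e \<in> F" for s
  obtain x where "x \<in> F" using assms(4) by blast
  then have "x \<in> {1..n}" using assms(3) by blast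
  then obtain s where "P s"
    using cyc_pow_reach[OF assms(1,2)] \<open>x \<in> F\<close> unfolding P_def by metis
  then have "P (Least P)" by (rule LeastI)
  moreover have "\<not> P t" if "t < Least P" for t using that by (rule not_less_Least)
  moreover have "nxt n F e = (cyc n ^^ Least P) e" by (simp add: nxt_def P_def[abs_def])
  ultimately show ?thesis using that[of "Least P"] unfolding P_def
    by (metis (no_types, lifting) less_le_trans less_imp_le)
qed

lemma nxt_in:
  assumes "n \<ge> 1" "e \<in> {1..n}" "F \<subseteq> {1..n}" "F \<noteq> {}"
  shows "nxt n F e \<in> F"
  using nxt_obtain[OF assms] by metis

lemma nxt_remove_other:
  assumes "n \<ge> 1" "e \<in> {1..n}" "F \<subseteq> {1..n}" "F \<noteq> {}" "nxt n F e \<noteq> w"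
  shows "nxt n (F - {w}) e = nxt n F e"
proof -
  obtain s where s: "1 \<le> s" "s \<le> n" "(cyc n ^^ s) e \<in> F" "nxt n F e = (cyc n ^^ s) e"
    "\<And>t. 1 \<le> t \<Longrightarrow> t < s \<Longrightarrow> (cyc n ^^ t) e \<notin> F"
    using nxt_obtain[OF assms(1-4)] by blast
  show ?thesis unfolding s(4) by (rule nxt_eqI) (use s assms(5) in auto)
qed

text \<open>No free spot lies between \<open>e\<close> and its first choice, so a car that finds
  this choice taken continues as if it had started there. Two cars with the same first choice thus
  share their second.\<close>

lemma nxt_remove_nxt:
  assumes "n \<ge> 1" "e \<in> {1..n}" "F \<subseteq> {1..n}" "F - {nxt n F e} \<noteq> {}"
  shows "nxt n (F - {nxt n F e}) e = nxt n (F - {nxt n F e}) (nxt n F e)"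
proof -
  define u where "u = nxt n F e"
  have "F \<noteq> {}" using assms(4) by blast
  from nxt_obtain[OF assms(1-3) this]
  obtain s where s: "1 \<le> s" "s \<le> n" "(cyc n ^^ s) e \<in> F" "nxt n F e = (cyc n ^^ s) e"
    "\<And>t. 1 \<le> t \<Longrightarrow> t < s \<Longrightarrow> (cyc n ^^ t) e \<notin> F" by blast
  have "F - {u} \<subseteq> {1..n}" "F - {u} \<noteq> {}" using assms(3,4) by (auto simp: u_def)
  from nxt_obtain[OF assms(1,2) this]
  obtain r where r: "1 \<le> r" "r \<le> n" "(cyc n ^^ r) e \<in> F - {u}"
    "nxt n (F - {u}) e = (cyc n ^^ r) e"
    "\<And>t. 1 \<le> t \<Longrightarrow> t < r \<Longrightarrow> (cyc n ^^ t) e \<notin> F - {u}" by blast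
  have "r \<noteq> s" using r(3) s(4) by (auto simp: u_def)
  moreover have "\<not> r < s" using s(5)[OF r(1)] r(3) by blast
  ultimately have less: "s < r" by linarith
  have u: "(cyc n ^^ t) u = (cyc n ^^ (t + s)) e" for t
    unfolding u_def s(4) by (simp add: funpow_add)
  have "nxt n (F - {u}) u = (cyc n ^^ (r - s)) u"
  proof (rule nxt_eqI)
    show "(cyc n ^^ (r - s)) u \<in> F - {u}" unfolding u using less r(3) by simp
    fix t assume "1 \<le> t" "t < r - s"
    then show "(cyc n ^^ t) u \<notin> F - {u}" unfolding u using less by (intro r(5)) auto
  qed (use less r(2) in auto)
  also have "\<dots> = (cyc n ^^ r) e" unfolding u using less by simp
  finally show ?thesis using r(4) by (simp add: u_def)
qed

lemma length_parking [simp]: "length (parking n Os es) = length es"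
  by (induction es) (simp_all add: parking_Cons)

lemma parking_distinct:
  assumes "n \<ge> 1" "Os \<subseteq> {1..n}" "set es \<subseteq> {1..n}" "length es \<le> card Os"
  shows "distinct (parking n Os es) \<and> set (parking n Os es) \<subseteq> Os"
  using assms(3,4)
proof (induction es)
  case (Cons e es)
  define ps where "ps = parking n Os es"
  have IH: "distinct ps" "set ps \<subseteq> Os" using Cons by (auto simp: ps_def)
  have "card (set ps) < card Os"
    using Cons.prems(2) distinct_card[OF IH(1)] by (simp add: ps_def)
  then have "Os - set ps \<noteq> {}" using card_mono[of "set ps" Os] by auto
  then have "nxt n (Os - set ps) e \<in> Os - set ps"
    using assms(1,2) Cons.prems by (intro nxt_in) auto
  then show ?case using IH unfolding parking_Cons ps_def[symmetric] by auto
qed simp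

lemma card_free:
  assumes "n \<ge> 1" "Os \<subseteq> {1..n}" "set es \<subseteq> {1..n}" "length es \<le> card Os"
  shows "card (Os - set (parking n Os es)) = card Os - length es"
proof -
  have d: "distinct (parking n Os es)" "set (parking n Os es) \<subseteq> Os"
    using parking_distinct[OF assms] by auto
  then show ?thesis using card_Diff_subset[OF _ d(2)] distinct_card[OF d(1)] by simp
qed

text \<open>Cars with different first choices do not interfere. If the choices agree, whichever
  parks first takes the spot and the other goes on from it, so the occupied pair is the same in
  either order.\<close>

lemma parking_swap:
  assumes "n \<ge> 1" "Os \<subseteq> {1..n}" "set (x # y # es) \<subseteq> {1..n}" "length (x # y # es) \<le> card Os"
  shows "set (parking n Os (x # y # es)) = set (parking n Os (y # x # es))"
proof -
  define ps where "ps = parking n Os es"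
  define F where "F = Os - set ps"
  have F: "F \<subseteq> {1..n}" using assms(2) by (auto simp: F_def)
  have "card F = card Os - length es"
    unfolding F_def ps_def by (rule card_free) (use assms in auto)
  then have two: "card F \<ge> 2" using assms(4) by simp
  have ne: "F - {w} \<noteq> {}" for w
    using two card_mono[of "{w}" F] by auto
  then have "F \<noteq> {}" by blast
  have xy: "x \<in> {1..n}" "y \<in> {1..n}" using assms(3) by auto
  define u v where "u = nxt n F x" and "v = nxt n F y"
  have "{nxt n (F - {v}) x, v} = {nxt n (F - {u}) y, u}"
  proof (cases "u = v")
    case True
    have "nxt n (F - {u}) x = nxt n (F - {u}) u" "nxt n (F - {v}) y = nxt n (F - {v}) v"
      unfolding u_def v_def using nxt_remove_nxt[OF assms(1) _ F ne] xy by blast+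
    then show ?thesis using True by simp
  next
    case False
    have "nxt n (F - {v}) x = u" "nxt n (F - {u}) y = v"
      unfolding u_def v_def
      by (rule nxt_remove_other[OF assms(1) _ F \<open>F \<noteq> {}\<close>];
          use xy False u_def v_def in simp)+
    then show ?thesis by auto
  qed
  moreover have "Os - set (p # ps) = F - {p}" for p by (auto simp: F_def)
  then have "parking n Os (x # y # es) = nxt n (F - {v}) x # v # ps"
    "parking n Os (y # x # es) = nxt n (F - {u}) y # u # ps"
    unfolding parking_Cons ps_def[symmetric] F_def[symmetric] u_def[symmetric] v_def[symmetric]
    by simp_all
  ultimately show ?thesis by auto
qed

text \<open>A car perceives those parked before it only through the set of occupied spots, so
  exchanges inside the list propagate to the front.\<close>

lemma set_parking_Cons_cong:
  "set (parking n Os es) = set (parking n Os es') \<Longrightarrow>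
   set (parking n Os (x # es)) = set (parking n Os (x # es'))"
  by (simp add: parking_Cons)

lemma parking_insort:
  assumes "n \<ge> 1" "Os \<subseteq> {1..n}" "set (x # es) \<subseteq> {1..n}" "length (x # es) \<le> card Os"
  shows "set (parking n Os (insort x es)) = set (parking n Os (x # es))"
  using assms(3,4)
proof (induction es)
  case (Cons y es)
  show ?case
  proof (cases "x \<le> y")
    case False
    have "set (parking n Os (insort x es)) = set (parking n Os (x # es))"
      using Cons by auto
    then have "set (parking n Os (y # insort x es)) = set (parking n Os (y # x # es))"
      by (rule set_parking_Cons_cong)
    also have "\<dots> = set (parking n Os (x # y # es))"
      by (rule parking_swap[OF assms(1,2)]) (use Cons.prems in auto)
    finally show ?thesis using False by simp
  qed simp
qed simp

lemma parking_sort: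
  assumes "n \<ge> 1" "Os \<subseteq> {1..n}" "set es \<subseteq> {1..n}" "length es \<le> card Os"
  shows "set (parking n Os (sort es)) = set (parking n Os es)"
  using assms(3,4)
proof (induction es)
  case (Cons e es)
  have "set (parking n Os (insort e (sort es))) = set (parking n Os (e # sort es))"
    by (rule parking_insort[OF assms(1,2)]) (use Cons.prems in auto)
  also have "\<dots> = set (parking n Os (e # es))"
    by (rule set_parking_Cons_cong) (use Cons in auto)
  finally show ?case by simp
qed simp

lemma residue_eq:
  assumes "n \<ge> 1" "Os \<subseteq> {1..n}" "set es \<subseteq> {1..n}" "card Os = length es + 1"
  shows "Os - set (parking n Os es) = {residue n es Os}"
proof -
  have "card (Os - set (parking n Os es)) = 1"
    using card_free[OF assms(1-3)] assms(4) by simp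
  then obtain x where x: "Os - set (parking n Os es) = {x}" by (rule card_1_singletonE)
  then have "residue n es Os = x" unfolding residue_def by simp
  with x show ?thesis by simp
qed

lemma residue_sort:
  assumes "n \<ge> 1" "Os \<subseteq> {1..n}" "set es \<subseteq> {1..n}" "card Os = length es + 1"
  shows "residue n (sort es) Os = residue n es Os"
  unfolding residue_def using parking_sort[OF assms(1-3)] assms(4) by simp

section \<open>Equivariance under the cyclic shift\<close>

lemma nxt_shift:
  assumes "n \<ge> 1"
  shows "nxt n ((cyc n ^^ m) ` F) ((cyc n ^^ m) e) = (cyc n ^^ m) (nxt n F e)"
proof -
  have inj: "inj (cyc n ^^ m)" using bij_cyc_pow[OF assms] by (rule bij_is_inj)
  have comm: "(cyc n ^^ s) ((cyc n ^^ m) e) = (cyc n ^^ m) ((cyc n ^^ s) e)" for s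
    by (simp add: add.commute flip: funpow_add[THEN fun_cong, unfolded comp_apply])
  show ?thesis unfolding nxt_def comm by (simp add: inj_image_mem_iff[OF inj])
qed

lemma parking_shift:
  assumes "n \<ge> 1"
  shows "parking n ((cyc n ^^ m) ` Os) (map (cyc n ^^ m) es) = map (cyc n ^^ m) (parking n Os es)"
proof (induction es)
  case (Cons e es)
  have inj: "inj (cyc n ^^ m)" using bij_cyc_pow[OF assms] by (rule bij_is_inj)
  show ?case
    by (simp add: parking_Cons Cons.IH nxt_shift[OF assms] flip: image_set_diff[OF inj])
qed simp

lemma residue_shift:
  assumes "n \<ge> 1" "Os \<subseteq> {1..n}" "set es \<subseteq> {1..n}" "card Os = length es + 1"
  shows "residue n (map (cyc n ^^ m) es) ((cyc n ^^ m) ` Os) = (cyc n ^^ m) (residue n es Os)"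
proof -
  have inj: "inj (cyc n ^^ m)" using bij_cyc_pow[OF assms(1)] by (rule bij_is_inj)
  have "(cyc n ^^ m) ` Os - set (parking n ((cyc n ^^ m) ` Os) (map (cyc n ^^ m) es))
      = (cyc n ^^ m) ` (Os - set (parking n Os es))"
    by (simp add: parking_shift[OF assms(1)] image_set_diff[OF inj])
  also have "\<dots> = {(cyc n ^^ m) (residue n es Os)}" unfolding residue_eq[OF assms] by simp
  finally show ?thesis unfolding residue_def[of n "map _ _"] by simp
qed

lemma cyc_pow_small: "1 \<le> e \<Longrightarrow> e + s \<le> n \<Longrightarrow> (cyc n ^^ s) e = e + s"
  using cyc_pow[of "e - 1" n s] by simp

lemma cyc_pow_wrap: "e \<in> {1..n} \<Longrightarrow> (cyc n ^^ (n + 1 - e)) e = 1"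
  by (cases e) (auto simp: cyc_pow)

text \<open>A car that passes from \<open>n\<close> to 1 would park there, since 1 is free. A car
  avoiding 1 therefore never wraps around, and cyclic search becomes search in the usual
  order.\<close>

lemma nxt_no_wrap:
  assumes "n \<ge> 1" "e \<in> {1..n}" "F \<subseteq> {1..n}" "1 \<in> F" "nxt n F e \<noteq> 1"
  shows "e < nxt n F e" "x \<in> F \<Longrightarrow> x \<le> e \<or> nxt n F e \<le> x"
proof -
  have "F \<noteq> {}" using assms(4) by blast
  from nxt_obtain[OF assms(1-3) this]
  obtain s where s: "1 \<le> s" "s \<le> n" "(cyc n ^^ s) e \<in> F" "nxt n F e = (cyc n ^^ s) e"
    "\<And>t. 1 \<le> t \<Longrightarrow> t < s \<Longrightarrow> (cyc n ^^ t) e \<notin> F" by blast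
  have wrap: "(cyc n ^^ (n + 1 - e)) e = 1" using assms(2) by (rule cyc_pow_wrap)
  have "s \<noteq> n + 1 - e" using assms(5) s(4) wrap by auto
  moreover have "1 \<le> n + 1 - e" using assms(2) by auto
  then have "\<not> n + 1 - e < s" using s(5)[of "n + 1 - e"] wrap assms(4) by auto
  ultimately have le: "e + s \<le> n" using assms(2) by auto
  then have nx: "nxt n F e = e + s" using s(4) cyc_pow_small assms(2) by simp
  then show "e < nxt n F e" using s(1) by simp
  assume x: "x \<in> F"
  show "x \<le> e \<or> nxt n F e \<le> x"
  proof (rule ccontr)
    assume "\<not> (x \<le> e \<or> nxt n F e \<le> x)"
    then have "1 \<le> x - e" "x - e < s" "e + (x - e) = x" using nx by auto
    then show False using s(5)[of "x - e"] cyc_pow_small[of e "x - e" n] assms(2) le x by simp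
  qed
qed

lemma nxt_linearI:
  assumes "e \<in> {1..n}" "y \<in> F" "e < y" "y \<le> n" "\<And>x. x \<in> F \<Longrightarrow> x \<le> e \<or> y \<le> x"
  shows "nxt n F e = y"
proof -
  have "nxt n F e = (cyc n ^^ (y - e)) e"
  proof (rule nxt_eqI)
    show "(cyc n ^^ (y - e)) e \<in> F" using assms by (simp add: cyc_pow_small)
    fix t assume t: "1 \<le> t" "t < y - e"
    then have "(cyc n ^^ t) e = e + t" using assms by (intro cyc_pow_small) auto
    then show "(cyc n ^^ t) e \<notin> F" using assms(5)[of "e + t"] t by auto
  qed (use assms in auto)
  then show ?thesis using assms by (simp add: cyc_pow_small)
qed

text \<open>The third conjunct carries the induction: no spot still free lies in
  \<open>(i, j]\<close> for a pair already formed. The next car takes such a free spot, which is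
  exactly what \<open>nested\<close> asks of its right endpoint.\<close>

lemma parking_nested:
  assumes "n \<ge> 1" "Os \<subseteq> {1..n}" "1 \<in> Os" "sorted es" "set es \<subseteq> {1..n}"
    and "length es \<le> card Os" "1 \<notin> set (parking n Os es)"
  shows "sorted_wrt nested (zip es (parking n Os es))
    \<and> (\<forall>t\<in>set (zip es (parking n Os es)). is_transp n t)
    \<and> (\<forall>t\<in>set (zip es (parking n Os es)). \<forall>x\<in>Os - set (parking n Os es). x \<le> fst t \<or> snd t < x)"
  using assms(4-)
proof (induction es)
  case (Cons e es)
  define ps where "ps = parking n Os es"
  define F where "F = Os - set ps"
  define p where "p = nxt n F e"
  have park: "parking n Os (e # es) = p # ps" by (simp add: parking_Cons p_def F_def ps_def)
  have "1 \<notin> set (parking n Os es)" "p \<noteq> 1" using Cons.prems(4) park by (auto simp: ps_def)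
  then have IH: "sorted_wrt nested (zip es ps)" "\<forall>t\<in>set (zip es ps). is_transp n t"
    "\<forall>t\<in>set (zip es ps). \<forall>x\<in>F. x \<le> fst t \<or> snd t < x"
    using Cons.IH Cons.prems unfolding ps_def F_def by auto
  have F: "F \<subseteq> {1..n}" "1 \<in> F" and e: "e \<in> {1..n}"
    using assms(2,3) Cons.prems \<open>1 \<notin> set (parking n Os es)\<close> by (auto simp: F_def ps_def)
  have less: "e < p" and gap: "x \<le> e \<or> p \<le> x" if "x \<in> F" for x
    using nxt_no_wrap[OF assms(1) e F] \<open>p \<noteq> 1\<close> that unfolding p_def by blast+
  have less: "e < p" using less[OF F(2)] .
  have pF: "p \<in> F" unfolding p_def using F by (intro nxt_in[OF assms(1) e]) auto
  have tr: "is_transp n (e, p)" using e less pF F(1) by (auto simp: is_transp_def)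
  have "nested (e, p) t" if t: "t \<in> set (zip es ps)" for t
  proof -
    have "fst t \<in> set es" using t by (metis set_zip_leftD prod.collapse)
    then have "e \<le> fst t" using Cons.prems(1) by simp
    then show ?thesis using IH(3) t pF by (auto simp: nested_def)
  qed
  moreover have "x \<le> e \<or> p < x" if "x \<in> F - {p}" for x using gap[of x] that by auto
  moreover have "Os - set (p # ps) = F - {p}" by (auto simp: F_def)
  ultimately show ?case unfolding park using IH tr by simp
qed simp

text \<open>Passing to the tail frees the spot \<open>snd g\<close>, and nestedness of
  \<open>g\<close> with the later pairs is what the last hypothesis requires of this additional
  spot.\<close>

lemma nested_parking:
  assumes "sorted_wrt nested ts" "\<forall>t\<in>set ts. is_transp n t" "snd ` set ts \<subseteq> Os"
    and "\<forall>t\<in>set ts. \<forall>x\<in>Os - snd ` set ts. x \<le> fst t \<or> snd t < x"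
  shows "parking n Os (map fst ts) = map snd ts"
  using assms
proof (induction ts)
  case (Cons g ts)
  have g: "is_transp n g" using Cons.prems(2) by simp
  have ng: "nested g t" "is_transp n t" if "t \<in> set ts" for t using Cons.prems that by auto
  have notin: "snd g \<notin> snd ` set ts"
  proof
    assume "snd g \<in> snd ` set ts"
    then obtain t where t: "t \<in> set ts" "snd t = snd g" by force
    then show False using ng[OF t(1)] by (auto simp: nested_def is_transp_def)
  qed
  have IH: "parking n Os (map fst ts) = map snd ts"
  proof (rule Cons.IH)
    show "\<forall>t\<in>set ts. \<forall>x\<in>Os - snd ` set ts. x \<le> fst t \<or> snd t < x"
    proof (intro ballI)
      fix t x assume t: "t \<in> set ts" and x: "x \<in> Os - snd ` set ts"
      show "x \<le> fst t \<or> snd t < x"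
      proof (cases "x = snd g")
        case True
        then show ?thesis using ng(1)[OF t] by (auto simp: nested_def)
      next
        case False
        then show ?thesis using Cons.prems(4) t x by simp
      qed
    qed
  qed (use Cons.prems in simp_all)
  have "nxt n (Os - snd ` set ts) (fst g) = snd g"
  proof (rule nxt_linearI)
    show "snd g \<in> Os - snd ` set ts" using Cons.prems(3) notin by simp
    fix x assume x: "x \<in> Os - snd ` set ts"
    show "x \<le> fst g \<or> snd g \<le> x"
    proof (cases "x = snd g")
      case False
      then have "x \<le> fst g \<or> snd g < x" using Cons.prems(4) x by simp
      then show ?thesis by auto
    qed simp
  qed (use g in \<open>auto simp: is_transp_def\<close>)
  then show ?case by (simp add: parking_Cons IH)
qed simp

lemma nested_distinct_snd:
  assumes "sorted_wrt nested ts" "\<forall>t\<in>set ts. is_transp n t"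
  shows "distinct (map snd ts)"
  using assms
proof (induction ts)
  case (Cons g ts)
  have "snd g \<noteq> snd t" if "t \<in> set ts" for t
  proof -
    have "nested g t" "is_transp n t" using Cons.prems that by auto
    then show ?thesis by (auto simp: nested_def is_transp_def)
  qed
  then show ?case using Cons by auto
qed simp

section \<open>The map from parking data to minimal prefixes\<close>

lemma Dom_iff: "(A, B) \<in> Dom n k \<longleftrightarrow> length A = k \<and> set A \<subseteq> {1..n} \<and> B \<subseteq> {1..n} \<and> card B = k + 1"
  by (auto simp: Dom_def)

lemma Dom_shift:
  assumes "n \<ge> 1" "(A, B) \<in> Dom n k"
  shows "(map (cyc n ^^ m) A, (cyc n ^^ m) ` B) \<in> Dom n k"
proof -
  have inj: "inj (cyc n ^^ m)" using bij_cyc_pow[OF assms(1)] by (rule bij_is_inj)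
  then have "card ((cyc n ^^ m) ` B) = card B" by (intro card_image) (rule inj_on_subset, auto)
  moreover have "(cyc n ^^ m) ` X \<subseteq> {1..n}" if "X \<subseteq> {1..n}" for X
    using that cyc_pow_image[OF assms(1)] by blast
  ultimately show ?thesis using assms(2) unfolding Dom_iff by simp
qed

lemma Dom_residue_eq:
  assumes "n \<ge> 1" "(A, B) \<in> Dom n k"
  shows "B - set (parking n B A) = {residue n A B}"
  by (rule residue_eq) (use assms in \<open>auto simp: Dom_iff\<close>)

lemma Dom_residue_in:
  assumes "n \<ge> 1" "(A, B) \<in> Dom n k"
  shows "residue n A B \<in> {1..n}"
  using Dom_residue_eq[OF assms] assms(2) by (auto simp: Dom_iff)

lemma Dom_residue_shift:
  assumes "n \<ge> 1" "(A, B) \<in> Dom n k"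
  shows "residue n (map (cyc n ^^ m) A) ((cyc n ^^ m) ` B) = (cyc n ^^ m) (residue n A B)"
  by (rule residue_shift) (use assms in \<open>auto simp: Dom_iff\<close>)

lemma cpow_normalises:
  assumes "r \<in> {1..n}"
  shows "cpow n (1 - int r) r = 1"
proof -
  obtain y where y: "r = Suc y" "y < n" using assms by (cases r) auto
  \<comment> \<open>With \<open>r = Suc y\<close> the exponent \<open>1 - r\<close> is
    \<open>- y\<close>, so the remainder is computed in the integers.\<close>
  define m where "m = nat (- int y mod int n)"
  have "int ((y + m) mod n) = (int y + (- int y mod int n)) mod int n"
    using y(2) by (simp add: m_def zmod_int)
  also have "\<dots> = 0" by (simp add: mod_add_right_eq)
  finally have "(y + m) mod n = 0" by simp
  then show ?thesis using y by (simp add: cpow_def cyc_pow m_def)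
qed

lemma shift_eq_pow:
  obtains m where "m < n \<or> n = 0" "cpow n (1 - int r) = cyc n ^^ m"
  using that[of "nat ((1 - int r) mod int n)"] unfolding cpow_def
  by (cases "n = 0") (auto simp: nat_less_iff)

lemma norm_props:
  assumes "n \<ge> 1" "(A, B) \<in> Dom n k"
  shows "(shiftA n A B, shiftB n A B) \<in> Dom n k" "residue n (shiftA n A B) (shiftB n A B) = 1"
proof -
  obtain m where m: "cpow n (1 - int (residue n A B)) = cyc n ^^ m" by (rule shift_eq_pow)
  show "(shiftA n A B, shiftB n A B) \<in> Dom n k"
    unfolding shiftA_def shiftB_def m by (rule Dom_shift[OF assms])
  show "residue n (shiftA n A B) (shiftB n A B) = 1"
    unfolding shiftA_def shiftB_def m Dom_residue_shift[OF assms]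
    using cpow_normalises[OF Dom_residue_in[OF assms]] unfolding m .
qed

lemma norm_of_residue_1:
  assumes "n \<ge> 1" "residue n A B = 1"
  shows "shiftA n A B = A" "shiftB n A B = B"
proof -
  have "cpow n (1 - int 1) = id" by (simp add: cpow_def)
  then show "shiftA n A B = A" "shiftB n A B = B"
    using assms(2) by (auto simp: shiftA_def shiftB_def)
qed

lemma norm_in_orbit:
  assumes "n \<ge> 1" "(A, B) \<in> Dom n k"
  obtains m where "m < n" "shiftA n A B = map (cyc n ^^ m) A" "shiftB n A B = (cyc n ^^ m) ` B"
  using shift_eq_pow[of n "residue n A B"] that assms(1) unfolding shiftA_def shiftB_def
  by (metis not_one_le_zero)

text \<open>Shifting before normalising and normalising directly are both powers of the long cycle
  that send the residue \<open>r\<close> to 1; by freeness they coincide.\<close>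

lemma norm_shift:
  assumes "n \<ge> 1" "(A, B) \<in> Dom n k"
  shows "shiftA n (map (cyc n ^^ m) A) ((cyc n ^^ m) ` B) = shiftA n A B"
    "shiftB n (map (cyc n ^^ m) A) ((cyc n ^^ m) ` B) = shiftB n A B"
proof -
  define r where "r = residue n A B"
  have r: "r \<in> {1..n}" unfolding r_def by (rule Dom_residue_in[OF assms])
  obtain a where a: "cpow n (1 - int ((cyc n ^^ m) r)) = cyc n ^^ a" by (rule shift_eq_pow)
  obtain b where b: "cpow n (1 - int r) = cyc n ^^ b" by (rule shift_eq_pow)
  have "(cyc n ^^ (a + m)) r = 1"
    using cpow_normalises[OF cyc_pow_in[OF r], of m] unfolding a by (simp add: funpow_add)
  moreover have "(cyc n ^^ b) r = 1" using cpow_normalises[OF r] unfolding b .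
  ultimately have "cyc n ^^ (a + m) = cyc n ^^ b" using cyc_pow_unique[OF assms(1) r] by metis
  then have "cyc n ^^ a \<circ> cyc n ^^ m = cyc n ^^ b" by (simp only: funpow_add)
  then show "shiftA n (map (cyc n ^^ m) A) ((cyc n ^^ m) ` B) = shiftA n A B"
    "shiftB n (map (cyc n ^^ m) A) ((cyc n ^^ m) ` B) = shiftB n A B"
    unfolding shiftA_def shiftB_def Dom_residue_shift[OF assms] r_def[symmetric] a b
    by (simp_all only: map_map image_comp)
qed

text \<open>The residue is normalised for \<open>shiftA\<close>, but the cars park in sorted order;
  \<open>residue_sort\<close> keeps 1 free. Hence \<open>shiftB\<close> can be reconstructed from
  the right endpoints, the source of injectivity on normalised pairs.\<close>

lemma gamma0_props:
  assumes "n \<ge> 1" "(A, B) \<in> Dom n k"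
  shows "gamma0 n A B \<in> Defs.Sigma n k" "map fst (gamma0 n A B) = Iseq n A B"
    "shiftB n A B = insert 1 (set (Jseq n A B))" "map snd (gamma0 n A B) = Jseq n A B"
    "length (shiftA n A B) = k" "\<forall>l<k. Iseq n A B ! l < Jseq n A B ! l"
proof -
  define A' B' where "A' = shiftA n A B" and "B' = shiftB n A B"
  have D: "(A', B') \<in> Dom n k" and res: "residue n A' B' = 1"
    unfolding A'_def B'_def by (rule norm_props[OF assms])+
  have d: "length A' = k" "set A' \<subseteq> {1..n}" "B' \<subseteq> {1..n}" "card B' = k + 1"
    using D by (auto simp: Dom_iff)
  have I: "Iseq n A B = sort A'" by (simp add: Iseq_def A'_def)
  have J: "Jseq n A B = parking n B' (sort A')" by (simp add: Jseq_def I B'_def)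
  have "residue n (sort A') B' = 1"
    using residue_sort[OF assms(1) d(3,2)] d res by simp
  moreover have "(sort A', B') \<in> Dom n k" using d by (simp add: Dom_iff)
  ultimately have free: "B' - set (parking n B' (sort A')) = {1}"
    using Dom_residue_eq[OF assms(1)] by metis
  have sub: "set (parking n B' (sort A')) \<subseteq> B'"
    using parking_distinct[OF assms(1) d(3), of "sort A'"] d by simp
  have one: "1 \<in> B'" "1 \<notin> set (parking n B' (sort A'))" using free by blast+
  have nst: "sorted_wrt nested (gamma0 n A B)" "\<forall>t\<in>set (gamma0 n A B). is_transp n t"
    using parking_nested[OF assms(1) d(3) one(1), of "sort A'"] d one(2)
    unfolding gamma0_def I J by simp_all
  have len: "length (gamma0 n A B) = k" by (simp add: gamma0_def I J d)
  show "gamma0 n A B \<in> Defs.Sigma n k" using nested_in_Sigma[OF assms(1) nst(2,1)] len by simp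
  show "map fst (gamma0 n A B) = Iseq n A B" "map snd (gamma0 n A B) = Jseq n A B"
    by (simp_all add: gamma0_def I J)
  show "shiftB n A B = insert 1 (set (Jseq n A B))"
    unfolding B'_def[symmetric] J using free sub by blast
  show "length (shiftA n A B) = k" using d(1) by (simp add: A'_def)
  show "\<forall>l<k. Iseq n A B ! l < Jseq n A B ! l"
  proof (intro allI impI)
    fix l assume "l < k"
    then have "(Iseq n A B ! l, Jseq n A B ! l) \<in> set (gamma0 n A B)"
      using len nth_mem[of l "gamma0 n A B"] unfolding gamma0_def by simp
    then show "Iseq n A B ! l < Jseq n A B ! l" using nst(2) by (auto simp: is_transp_def)
  qed
qed

text \<open>Neither the resulting left endpoints nor the product involve \<open>s\<close>. Together
  with \<open>Sigma_unique\<close> this gives independence of the sorting permutation.\<close>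

lemma act_gamma0_props:
  assumes "n \<ge> 1" "(A, B) \<in> Dom n k"
    and s: "s permutes {1..k}" "seq_act s (shiftA n A B) = Iseq n A B"
  shows "act (inv s) (gamma0 n A B) \<in> Defs.Sigma n k"
    "map fst (act (inv s) (gamma0 n A B)) = shiftA n A B"
    "prodT (act (inv s) (gamma0 n A B)) = prodT (gamma0 n A B)"
proof -
  note g = gamma0_props[OF assms(1,2)]
  note a = act_props[OF g(1) permutes_inv[OF s(1)]]
  show "act (inv s) (gamma0 n A B) \<in> Defs.Sigma n k"
    "prodT (act (inv s) (gamma0 n A B)) = prodT (gamma0 n A B)" by (rule a)+
  have "seq_act (inv s) (Iseq n A B) = seq_act (inv s \<circ> s) (shiftA n A B)"
    unfolding s(2)[symmetric] using s(1) g(5) by (intro seq_act_comp[symmetric]) (auto intro: permutes_inv)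
  also have "\<dots> = shiftA n A B" unfolding permutes_inv_o[OF s(1)] by (rule seq_act_id)
  finally show "map fst (act (inv s) (gamma0 n A B)) = shiftA n A B" unfolding a(2) g(2) .
qed

lemma Gamma_props:
  assumes "n \<ge> 1" "(A, B) \<in> Dom n k"
  shows "Gamma n A B \<in> Defs.Sigma n k" "map fst (Gamma n A B) = shiftA n A B"
    "prodT (Gamma n A B) = prodT (gamma0 n A B)"
proof -
  have len: "length A = k" using assms(2) by (simp add: Dom_iff)
  let ?P = "\<lambda>s. s permutes {1..length A} \<and> seq_act s (shiftA n A B) = Iseq n A B"
  have "\<exists>s. ?P s"
    using ex_seq_act_sort[of "shiftA n A B"] gamma0_props(5)[OF assms] len by (simp add: Iseq_def)
  then have "?P (Eps ?P)" by (rule someI_ex)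
  then have s: "Eps ?P permutes {1..k}" "seq_act (Eps ?P) (shiftA n A B) = Iseq n A B"
    using len by auto
  show "Gamma n A B \<in> Defs.Sigma n k" "map fst (Gamma n A B) = shiftA n A B"
    "prodT (Gamma n A B) = prodT (gamma0 n A B)"
    unfolding Gamma_def by (rule act_gamma0_props[OF assms s])+
qed

lemma Gamma_eq_iff_norm:
  assumes "n \<ge> 1" and p: "(A, B) \<in> Dom n k" and q: "(A', B') \<in> Dom n k"
  shows "Gamma n A B = Gamma n A' B' \<longleftrightarrow> shiftA n A B = shiftA n A' B' \<and> shiftB n A B = shiftB n A' B'"
proof
  assume eq: "Gamma n A B = Gamma n A' B'"
  note Gp = Gamma_props[OF assms(1) p] and Gq = Gamma_props[OF assms(1) q]
  note gp = gamma0_props[OF assms(1) p] and gq = gamma0_props[OF assms(1) q]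
  have A: "shiftA n A B = shiftA n A' B'" using Gp(2) Gq(2) eq by simp
  \<comment> \<open>Equal images have the same product and the same left endpoints, which determine
    the sorted tuples and then, through their right endpoints, the sets
    \<open>shiftB\<close>.\<close>
  have "gamma0 n A B = gamma0 n A' B'"
  proof (rule Sigma_unique[OF assms(1) gp(1) gq(1)])
    show "map fst (gamma0 n A B) = map fst (gamma0 n A' B')"
      unfolding gp(2) gq(2) Iseq_def A ..
    show "prodT (gamma0 n A B) = prodT (gamma0 n A' B')" using Gp(3) Gq(3) eq by simp
  qed
  then have "shiftB n A B = shiftB n A' B'"
    unfolding gp(3) gq(3) gp(4)[symmetric] gq(4)[symmetric] by simp
  with A show "shiftA n A B = shiftA n A' B' \<and> shiftB n A B = shiftB n A' B'" by blast
next
  assume "shiftA n A B = shiftA n A' B' \<and> shiftB n A B = shiftB n A' B'"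
  moreover have "length A = length A'" using p q by (simp add: Dom_iff)
  ultimately show "Gamma n A B = Gamma n A' B'"
    by (simp add: Gamma_def gamma0_def Jseq_def Iseq_def)
qed

lemma Gamma_surj:
  assumes n: "n \<ge> 1" and ts: "ts \<in> Defs.Sigma n k"
  obtains A B where "(A, B) \<in> Dom n k" "Gamma n A B = ts"
proof -
  have len: "length ts = k" using ts by (simp add: Defs.Sigma_def)
  obtain ws where ws: "set ws \<subseteq> {1..<k}" "map fst (apply_word ws ts) = sort (map fst ts)"
    using Sigma_sort[OF ts] by metis
  define us where "us = apply_word ws ts"
  have us: "us \<in> Defs.Sigma n k" unfolding us_def by (rule apply_word_Sigma[OF ts ws(1)])
  have prod_us: "prodT us = prodT ts"
    using apply_word_props[OF Sigma_is_transp[OF ts], of ws] ws(1) len by (simp add: us_def)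
  have fst_us: "map fst us = sort (map fst ts)" using ws(2) by (simp add: us_def)
  have nst: "sorted_wrt nested us" by (rule sorted_in_Sigma_nested[OF n us]) (simp add: fst_us)
  have tr: "\<forall>t\<in>set us. is_transp n t" by (rule Sigma_is_transp[OF us])
  \<comment> \<open>The left endpoints come from \<open>ts\<close>, the spots from the sorted
    \<open>us\<close>, whose right endpoints are the ones produced by parking. Adding 1 supplies the
    free spot and makes the pair already normalised.\<close>
  define A B where "A = map fst ts" and "B = insert 1 (snd ` set us)"
  have one: "1 \<notin> snd ` set us" using tr by (auto simp: is_transp_def)
  have "card (snd ` set us) = k"
    using distinct_card[OF nested_distinct_snd[OF nst tr]] us by (simp add: Defs.Sigma_def)
  then have "card B = k + 1" using one by (simp add: B_def)
  moreover have "B \<subseteq> {1..n}" using tr n by (auto simp: B_def is_transp_def)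
  moreover have "set A \<subseteq> {1..n}"
    using Sigma_is_transp[OF ts] by (auto simp: A_def is_transp_def)
  ultimately have D: "(A, B) \<in> Dom n k" using len by (simp add: Dom_iff A_def)
  have Ds: "(sort A, B) \<in> Dom n k" using D by (simp add: Dom_iff)
  have diff: "B - snd ` set us = {1}" using one by (auto simp: B_def)
  have park: "parking n B (sort A) = map snd us"
    unfolding A_def fst_us[symmetric]
    by (rule nested_parking[OF nst tr]) (use tr in \<open>auto simp: diff B_def is_transp_def\<close>)
  have "residue n (sort A) B = 1"
    using Dom_residue_eq[OF n Ds] unfolding park by (simp add: diff)
  then have res: "residue n A B = 1"
    using residue_sort[OF n, of B A] D by (simp add: Dom_iff)
  note nrm = norm_of_residue_1[OF n res]
  have "gamma0 n A B = us"
    unfolding gamma0_def Jseq_def Iseq_def nrm park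
    unfolding A_def fst_us[symmetric] by (rule zip_map_fst_snd)
  then have "Gamma n A B = ts"
    using Gamma_props[OF n D] prod_us nrm(1)
    by (intro Sigma_unique[OF n _ ts]) (simp_all add: A_def)
  with D show ?thesis by (rule that)
qed

lemma Gamma_eq_iff_orbit:
  assumes n: "n \<ge> 1" and p: "p \<in> Dom n k" and q: "q \<in> Dom n k"
  shows "Gamma n (fst p) (snd p) = Gamma n (fst q) (snd q) \<longleftrightarrow> q \<in> shift_orbit n p"
proof -
  obtain A B A' B' where pq: "p = (A, B)" "q = (A', B')" by (cases p; cases q)
  have D: "(A, B) \<in> Dom n k" "(A', B') \<in> Dom n k" using p q pq by auto
  show ?thesis
  proof
    assume "Gamma n (fst p) (snd p) = Gamma n (fst q) (snd q)"
    then have eq: "shiftA n A B = shiftA n A' B'" "shiftB n A B = shiftB n A' B'"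
      using Gamma_eq_iff_norm[OF n D] by (auto simp: pq)
    obtain a where a: "shiftA n A B = map (cyc n ^^ a) A" "shiftB n A B = (cyc n ^^ a) ` B"
      using norm_in_orbit[OF n D(1)] by blast
    obtain b where b: "b < n" "shiftA n A' B' = map (cyc n ^^ b) A'"
      "shiftB n A' B' = (cyc n ^^ b) ` B'"
      using norm_in_orbit[OF n D(2)] by blast
    \<comment> \<open>The inverse of the \<open>b\<close>-th power as a natural power;
      \<open>b < n\<close> gives \<open>n - b + b = n\<close>.\<close>
    define c where "c = cyc n ^^ (n - b)"
    have cb: "c \<circ> cyc n ^^ b = id"
      unfolding c_def using b(1) cyc_pow_n[OF n] by (simp flip: funpow_add)
    have ca: "c \<circ> cyc n ^^ a = cyc n ^^ (n - b + a)" by (simp add: c_def funpow_add)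
    have "A' = map (c \<circ> cyc n ^^ b) A'" "B' = (c \<circ> cyc n ^^ b) ` B'" by (simp_all add: cb)
    moreover have "map (c \<circ> cyc n ^^ b) A' = map (c \<circ> cyc n ^^ a) A"
      "(c \<circ> cyc n ^^ b) ` B' = (c \<circ> cyc n ^^ a) ` B"
      using a b(2,3) eq by (simp_all only: map_map[symmetric] image_comp[symmetric])
    ultimately show "q \<in> shift_orbit n p" unfolding shift_orbit_def pq ca by auto
  next
    assume "q \<in> shift_orbit n p"
    then obtain m where "A' = map (cyc n ^^ m) A" "B' = (cyc n ^^ m) ` B"
      by (auto simp: shift_orbit_def pq)
    then show "Gamma n (fst p) (snd p) = Gamma n (fst q) (snd q)"
      using Gamma_eq_iff_norm[OF n D] norm_shift[OF n D(1), of m] by (simp add: pq)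
  qed
qed

lemma shift_orbit_subset_Dom:
  assumes "n \<ge> 1" "p \<in> Dom n k"
  shows "shift_orbit n p \<subseteq> Dom n k"
  using Dom_shift[OF assms(1), of "fst p" "snd p" k] assms(2) by (auto simp: shift_orbit_def)

lemma card_shift_orbit:
  assumes n: "n \<ge> 1" and p: "p \<in> Dom n k"
  shows "card (shift_orbit n p) = n"
proof -
  define f where "f m = (map (cyc n ^^ m) (fst p), (cyc n ^^ m) ` snd p)" for m
  have D: "(fst p, snd p) \<in> Dom n k" using p by simp
  have "shift_orbit n p = f ` {..<n}"
  proof
    show "shift_orbit n p \<subseteq> f ` {..<n}"
    proof
      fix q assume "q \<in> shift_orbit n p"
      then obtain m where "q = f m" by (auto simp: shift_orbit_def f_def)
      then have "q = f (m mod n)" by (simp add: f_def cyc_pow_mod[OF n])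
      then show "q \<in> f ` {..<n}" using n by auto
    qed
  qed (auto simp: shift_orbit_def f_def)
  moreover have "inj_on f {..<n}"
  proof (rule inj_onI)
    fix s t assume st: "s \<in> {..<n}" "t \<in> {..<n}" "f s = f t"
    \<comment> \<open>A rotation may fix \<open>B\<close>, but the residue is a single point that
      follows the shift, so it tells the \<open>n\<close> shifts apart.\<close>
    then have "(cyc n ^^ s) (residue n (fst p) (snd p)) = (cyc n ^^ t) (residue n (fst p) (snd p))"
      unfolding Dom_residue_shift[OF n D, symmetric] f_def by (metis prod.inject)
    from cyc_pow_eqD[OF Dom_residue_in[OF n D] this] show "s = t" using st by simp
  qed
  ultimately show ?thesis by (simp add: card_image)
qed

section \<open>Counting by fibres\<close>

lemma finite_Dom: "finite (Dom n k)"
  and card_Dom: "card (Dom n k) = n ^ k * (n choose (k + 1))"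
proof -
  have e: "{A. length A = k \<and> set A \<subseteq> {1..n}} = {A. set A \<subseteq> {1..n} \<and> length A = k}" by auto
  show "finite (Dom n k)"
    unfolding Dom_def e
    by (rule finite_cartesian_product[OF finite_lists_length_eq]) simp_all
  show "card (Dom n k) = n ^ k * (n choose (k + 1))"
    unfolding Dom_def e card_cartesian_product
    by (simp add: card_lists_length_eq n_subsets)
qed

lemma Gamma_image:
  assumes "n \<ge> 1"
  shows "(\<lambda>(A, B). Gamma n A B) ` Dom n k = Defs.Sigma n k"
proof
  show "(\<lambda>(A, B). Gamma n A B) ` Dom n k \<subseteq> Defs.Sigma n k"
  proof (rule image_subsetI, clarify)
    fix A B assume "(A, B) \<in> Dom n k"
    then show "Gamma n A B \<in> Defs.Sigma n k" by (rule Gamma_props(1)[OF assms])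
  qed
  show "Defs.Sigma n k \<subseteq> (\<lambda>(A, B). Gamma n A B) ` Dom n k"
  proof
    fix ts assume "ts \<in> Defs.Sigma n k"
    then obtain A B where "(A, B) \<in> Dom n k" "Gamma n A B = ts"
      using Gamma_surj[OF assms] by blast
    then show "ts \<in> (\<lambda>(A, B). Gamma n A B) ` Dom n k" by force
  qed
qed

text \<open>Stated with the factor \<open>n\<close> on the left because the exponent
  \<open>k - 1\<close> is negative for \<open>k = 0\<close>; the division takes place over the
  reals.\<close>

lemma card_Sigma_times:
  assumes n: "n \<ge> 1"
  shows "n * card (Defs.Sigma n k) = n ^ k * (n choose (k + 1))"
proof -
  define G where "G p = Gamma n (fst p) (snd p)" for p
  have img: "G ` Dom n k = Defs.Sigma n k"
  proof -
    have "G = (\<lambda>(A, B). Gamma n A B)" by (rule ext) (simp add: G_def split_beta)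
    then show ?thesis using Gamma_image[OF n] by (simp only:)
  qed
  have fin: "finite (Defs.Sigma n k)" unfolding img[symmetric] by (rule finite_imageI[OF finite_Dom])
  have fibre: "card {p \<in> Dom n k. G p = ts} = n" if ts: "ts \<in> Defs.Sigma n k" for ts
  proof -
    obtain p where p: "p \<in> Dom n k" "G p = ts"
      using ts unfolding img[symmetric] by blast
    have "{q \<in> Dom n k. G q = ts} = shift_orbit n p"
    proof (intro equalityI subsetI)
      fix q assume "q \<in> {q \<in> Dom n k. G q = ts}"
      then have q: "q \<in> Dom n k" "G p = G q" using p(2) by simp_all
      then show "q \<in> shift_orbit n p"
        using Gamma_eq_iff_orbit[OF n p(1) q(1)] unfolding G_def by blast
    next
      fix q assume o: "q \<in> shift_orbit n p"
      then have q: "q \<in> Dom n k" using shift_orbit_subset_Dom[OF n p(1)] by blast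
      then have "G p = G q" using Gamma_eq_iff_orbit[OF n p(1) q] o unfolding G_def by blast
      then show "q \<in> {q \<in> Dom n k. G q = ts}" using q p(2) by simp
    qed
    then show ?thesis using card_shift_orbit[OF n p(1)] by simp
  qed
  have "Dom n k = (\<Union>ts\<in>Defs.Sigma n k. {p \<in> Dom n k. G p = ts})"
  proof (intro equalityI subsetI)
    fix p assume "p \<in> Dom n k"
    moreover from this have "G p \<in> Defs.Sigma n k" unfolding img[symmetric] by (rule imageI)
    ultimately show "p \<in> (\<Union>ts\<in>Defs.Sigma n k. {p \<in> Dom n k. G p = ts})" by simp
  qed simp
  then have "card (Dom n k) = card (\<Union>ts\<in>Defs.Sigma n k. {p \<in> Dom n k. G p = ts})"
    by (rule arg_cong[of _ _ card])
  also have "\<dots> = (\<Sum>ts\<in>Defs.Sigma n k. card {p \<in> Dom n k. G p = ts})"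
    by (rule card_UN_disjoint[OF fin]) (use finite_Dom[of n k] in auto)
  also have "\<dots> = (\<Sum>ts\<in>Defs.Sigma n k. n)" by (rule sum.cong[OF refl fibre])
  also have "\<dots> = n * card (Defs.Sigma n k)" by simp
  finally show ?thesis unfolding card_Dom by (rule sym)
qed

theorem mainTheorem13:
  fixes n k :: nat
  assumes "n \<ge> 1"
  shows "(\<forall>(A, B) \<in> Dom n k.
            (\<forall>l < k. Iseq n A B ! l < Jseq n A B ! l)
          \<and> gamma0 n A B \<in> Sigma n k
          \<and> Gamma n A B \<in> Sigma n k
          \<and> (\<forall>s. s permutes {1..k} \<and> seq_act s (shiftA n A B) = Iseq n A B
                 \<longrightarrow> act (inv s) (gamma0 n A B) = Gamma n A B))
    \<and> (\<lambda>(A, B). Gamma n A B) ` Dom n k = Sigma n k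
    \<and> (\<forall>p \<in> Dom n k. \<forall>q \<in> Dom n k.
          (Gamma n (fst p) (snd p) = Gamma n (fst q) (snd q)) \<longleftrightarrow> q \<in> shift_orbit n p)
    \<and> (\<forall>p \<in> Dom n k. card (shift_orbit n p) = n)
    \<and> real (card (Sigma n k)) = real n powi (int k - 1) * real (n choose (k + 1))"
proof (intro conjI)
  show "\<forall>(A, B) \<in> Dom n k.
      (\<forall>l < k. Iseq n A B ! l < Jseq n A B ! l)
      \<and> gamma0 n A B \<in> Sigma n k
      \<and> Gamma n A B \<in> Sigma n k
      \<and> (\<forall>s. s permutes {1..k} \<and> seq_act s (shiftA n A B) = Iseq n A B
             \<longrightarrow> act (inv s) (gamma0 n A B) = Gamma n A B)"
  proof (clarify, intro conjI allI impI)
    fix A B assume D: "(A, B) \<in> Dom n k"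
    note g = gamma0_props[OF assms D] and G = Gamma_props[OF assms D]
    show "Iseq n A B ! l < Jseq n A B ! l" if "l < k" for l using g(6) that by blast
    show "gamma0 n A B \<in> Sigma n k" "Gamma n A B \<in> Sigma n k" by (rule g(1), rule G(1))
    fix s assume s: "s permutes {1..k} \<and> seq_act s (shiftA n A B) = Iseq n A B"
    note a = act_gamma0_props[OF assms D conjunct1[OF s] conjunct2[OF s]]
    show "act (inv s) (gamma0 n A B) = Gamma n A B"
      by (rule Sigma_unique[OF assms a(1) G(1)]) (simp_all only: a G)
  qed
  show "(\<lambda>(A, B). Gamma n A B) ` Dom n k = Sigma n k" by (rule Gamma_image[OF assms])
  show "\<forall>p \<in> Dom n k. \<forall>q \<in> Dom n k.
      (Gamma n (fst p) (snd p) = Gamma n (fst q) (snd q)) \<longleftrightarrow> q \<in> shift_orbit n p"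
    using Gamma_eq_iff_orbit[OF assms] by blast
  show "\<forall>p \<in> Dom n k. card (shift_orbit n p) = n" using card_shift_orbit[OF assms] by blast
  have "real n * real (card (Sigma n k)) = real n ^ k * real (n choose (k + 1))"
    using arg_cong[OF card_Sigma_times[OF assms, of k], of real] by simp
  then have "real (card (Sigma n k)) = real n ^ k / real n * real (n choose (k + 1))"
    using assms by (simp add: field_simps)
  also have "real n ^ k / real n = real n powi (int k - 1)"
    using assms by (simp add: power_int_diff)
  finally show "real (card (Sigma n k)) = real n powi (int k - 1) * real (n choose (k + 1))" .
qed

end
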